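(* Let $t=2t'$ be an even positive integer. The following equality of formal power series in $x$ holds: $$\sum_{\lambda \in DD_{(t)}} \delta_{\lambda}\, x^{|\lambda|/2} =\prod_{k \geq 1} \frac{(1-x^k) (1-x^{kt})^{t'-1}}{1-x^{kt'}}.$$
   Context: A partition $\lambda=(\lambda_1,\ldots,\lambda_\ell)$ is a finite non-increasing sequence of positive integers (possibly empty), with weight $|\lambda|=\sum_i\lambda_i$ and conjugate $\lambda^*$ (reflection of the Ferrers diagram in the principal diagonal). $D(\lambda)$ is the side length of the largest square contained in the Ferrers diagram (Durfee square), and $\delta_\lambda=(-1)^{D(\lambda)}$. With $a_i=\lambda_i-i$ and $b_i=\lambda_i^*-i$ for $1\le i\le D(\lambda)$, $\lambda$ is doubled distinct if $a_i=b_i+1$ for all $i\in\{1,\ldots,D(\lambda)\}$. A partition is a $t$-core if none of the hook lengths of its boxes is a multiple of $t$. $DD_{(t)}$ is the set of doubled distinct $t$-cores (including the empty partition). *)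

theory Defs
  imports "HOL-Analysis.Analysis" "HOL-Computational_Algebra.Formal_Power_Series"
begin

type_synonym partition = "nat list"

definition is_partition :: "partition \<Rightarrow> bool" where
  "is_partition la \<longleftrightarrow> sorted_wrt (\<ge>) la \<and> (\<forall>p\<in>set la. 0 < p)"

definition weight :: "partition \<Rightarrow> nat" where
  "weight la = sum_list la"

text \<open>Parts are indexed from 1, with \<open>\<lambda>\<^sub>i = 0\<close> for \<open>i\<close> beyond the length (and for \<open>i = 0\<close>).\<close>

definition part :: "partition \<Rightarrow> nat \<Rightarrow> nat" where
  "part la i = (if 1 \<le> i \<and> i \<le> length la then la ! (i - 1) else 0)"

text \<open>The box in row \<open>i\<close> and column \<open>j\<close> is the pair \<open>(i, j)\<close>, both counted from 1.\<close>

definition ferrers :: "partition \<Rightarrow> (nat \<times> nat) set" where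
  "ferrers la = {(i, j). 1 \<le> j \<and> j \<le> part la i}"

definition conjugate :: "partition \<Rightarrow> partition" where
  "conjugate la = map (\<lambda>j. card {i. (i, j) \<in> ferrers la}) [1..<Suc (part la 1)]"

definition durfee :: "partition \<Rightarrow> nat" where
  "durfee la = Max {d. {1..d} \<times> {1..d} \<subseteq> ferrers la}"

definition delta :: "partition \<Rightarrow> int" where
  "delta la = (-1) ^ durfee la"

definition doubled_distinct :: "partition \<Rightarrow> bool" where
  "doubled_distinct la \<longleftrightarrow>
     (\<forall>i\<in>{1..durfee la}. int (part la i) - int i = (int (part (conjugate la) i) - int i) + 1)"

text \<open>The hook of a box consists of the box, the boxes to its right in the same row and
  the boxes below it in the same column.\<close>

definition hook :: "partition \<Rightarrow> nat \<times> nat \<Rightarrow> (nat \<times> nat) set" where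
  "hook la b = {(i, j) \<in> ferrers la. (i = fst b \<and> snd b \<le> j) \<or> (j = snd b \<and> fst b \<le> i)}"

definition hook_length :: "partition \<Rightarrow> nat \<times> nat \<Rightarrow> nat" where
  "hook_length la b = card (hook la b)"

definition t_core :: "nat \<Rightarrow> partition \<Rightarrow> bool" where
  "t_core t la \<longleftrightarrow> (\<forall>b\<in>ferrers la. \<not> t dvd hook_length la b)"

definition DD :: "nat \<Rightarrow> partition set" where
  "DD t = {la. is_partition la \<and> doubled_distinct la \<and> t_core t la}"

lemma ferrers_column:
  assumes "is_partition la" "1 \<le> j"
  shows "\<exists>m. {i. (i, j) \<in> ferrers la} = {1..m}"
proof -
  define A where "A = {i. (i, j) \<in> ferrers la}"
  have A_iff: "i \<in> A \<longleftrightarrow> j \<le> part la i" for i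
    using assms(2) by (simp add: A_def ferrers_def)
  have sub: "A \<subseteq> {1..length la}"
    using assms(2) by (auto simp: A_iff part_def split: if_splits)
  then have fin: "finite A" by (rule finite_subset) simp
  have mono: "part la i' \<le> part la i" if "1 \<le> i" "i \<le> i'" for i i'
  proof (cases "i < i' \<and> i' \<le> length la")
    case True
    then have "la ! (i' - 1) \<le> la ! (i - 1)"
      using assms(1) that by (auto simp: is_partition_def sorted_wrt_iff_nth_less)
    then show ?thesis using True that by (simp add: part_def)
  next
    case False
    then show ?thesis using that by (cases "i = i'") (auto simp: part_def)
  qed
  have "\<exists>m. A = {1..m}"
  proof (cases "A = {}")
    case True
    then show ?thesis by (intro exI[of _ 0]) simp
  next
    case False
    define M where "M = Max A"
    have "M \<in> A" using fin False unfolding M_def by (rule Max_in)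
    moreover have "i \<le> M" if "i \<in> A" for i
      unfolding M_def using fin that by (rule Max_ge)
    moreover have "i \<in> A" if "1 \<le> i" "i \<le> M" for i
      using mono[OF that] \<open>M \<in> A\<close> unfolding A_iff by linarith
    moreover have "1 \<le> i" if "i \<in> A" for i
      using subsetD[OF sub that] by simp
    ultimately have "A = {1..M}"
      unfolding set_eq_iff atLeastAtMost_iff by metis
    then show ?thesis ..
  qed
  then show ?thesis by (simp add: A_def)
qed

lemma nth_conjugate:
  assumes "k < part la 1"
  shows "conjugate la ! k = card {i. (i, Suc k) \<in> ferrers la}"
proof -
  have "[1..<Suc (part la 1)] ! k = Suc k"
    using nth_upt[of 1 k "Suc (part la 1)"] assms by (simp del: upt_Suc)
  then show ?thesis
    unfolding conjugate_def using assms by (subst nth_map) (simp_all del: upt_Suc)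
qed

lemma part_conjugate:
  "part (conjugate la) j = (if 1 \<le> j \<and> j \<le> part la 1 then card {i. (i, j) \<in> ferrers la} else 0)"
proof -
  have "length (conjugate la) = part la 1"
    by (simp add: conjugate_def del: upt_Suc)
  moreover have "conjugate la ! (j - 1) = card {i. (i, j) \<in> ferrers la}"
    if "1 \<le> j" "j \<le> part la 1"
    using that by (simp add: nth_conjugate)
  ultimately show ?thesis
    unfolding part_def[of "conjugate la"] by simp
qed

lemma ferrers_conjugate:
  assumes "is_partition la"
  shows "ferrers (conjugate la) = prod.swap ` ferrers la"
proof -
  have "(j, i) \<in> ferrers (conjugate la) \<longleftrightarrow> (i, j) \<in> ferrers la" for i j
  proof (cases "1 \<le> j")
    case True
    then obtain m where m: "{i. (i, j) \<in> ferrers la} = {1..m}"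
      using ferrers_column[OF assms] by blast
    have *: "(i, j) \<in> ferrers la \<longleftrightarrow> 1 \<le> i \<and> i \<le> m" for i
      using m by (simp add: set_eq_iff)
    have "j \<le> part la 1 \<longleftrightarrow> 1 \<le> m" using *[of 1] True by (simp add: ferrers_def)
    then have "part (conjugate la) j = m"
      using True unfolding part_conjugate m by (cases "m = 0") auto
    then show ?thesis unfolding * by (simp add: ferrers_def)
  next
    case False
    then have "part (conjugate la) j = 0" by (simp add: part_def)
    then show ?thesis using False by (simp add: ferrers_def)
  qed
  then show ?thesis
    by (intro set_eqI) (metis pair_in_swap_image surj_pair)
qed

lemma is_partition_conjugate:
  assumes "is_partition la"
  shows "is_partition (conjugate la)"
proof -
  have fin: "finite {i. (i, j) \<in> ferrers la}" if "1 \<le> j" for j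
    using ferrers_column[OF assms that] by auto
  have "sorted_wrt (\<ge>) (conjugate la)"
    unfolding sorted_wrt_iff_nth_less
  proof (intro allI impI)
    fix k l assume kl: "k < l" "l < length (conjugate la)"
    then have "l < part la 1" by (simp add: conjugate_def del: upt_Suc)
    moreover have "card {i. (i, Suc l) \<in> ferrers la} \<le> card {i. (i, Suc k) \<in> ferrers la}"
      using kl(1) by (intro card_mono fin) (auto simp: ferrers_def)
    ultimately show "conjugate la ! l \<le> conjugate la ! k"
      using kl(1) by (simp add: nth_conjugate)
  qed
  moreover have "0 < p" if p: "p \<in> set (conjugate la)" for p
  proof -
    obtain j where j: "1 \<le> j" "j \<le> part la 1" "p = card {i. (i, j) \<in> ferrers la}"
      using p by (auto simp: conjugate_def simp del: upt_Suc)
    then have "1 \<in> {i. (i, j) \<in> ferrers la}" by (simp add: ferrers_def)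
    then show ?thesis unfolding j(3) card_gt_0_iff using fin[OF j(1)] by blast
  qed
  ultimately show ?thesis by (simp add: is_partition_def)
qed

text \<open>A doubled distinct partition has even weight, namely twice the sum of its
  \<open>a\<^sub>i = \<lambda>\<^sub>i - i\<close> over \<open>1 \<le> i \<le> D(\<lambda>)\<close>, so the integer division in the exponent is exact.
  Infinite sums and products of formal power series refer to the \<open>X\<close>-adic metric of the
  library, in which a net converges iff, for each degree, the coefficients up to that degree
  are eventually constant.\<close>

definition DD_term :: "partition \<Rightarrow> rat fps" where
  "DD_term la = fps_const (of_int (delta la)) * fps_X ^ (weight la div 2)"

end

theory Submission
  imports Defs
begin

text \<open>A doubled distinct partition is determined by the finite set \<open>A\<close> of the positive numbers
  \<open>a\<^sub>i = \<lambda>\<^sub>i - i\<close>; its weight is twice the sum of \<open>A\<close> and its Durfee square has side \<open>|A|\<close>. The set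
  \<open>X = {\<lambda>\<^sub>i - i | i \<ge> 1}\<close> consists of \<open>A\<close> and of the \<open>- n\<close> with \<open>n > 0\<close> not in \<open>A\<close>, and \<open>\<lambda>\<close> is a
  \<open>t\<close>-core iff \<open>X - t \<subseteq> X\<close>. Hence \<open>X\<close> meets every residue class modulo \<open>t\<close> in an initial segment. By
  symmetry the classes of \<open>0\<close> and \<open>t'\<close> contribute nothing to \<open>A\<close>, and the classes of \<open>i\<close> and \<open>t - i\<close>
  are governed by one integer \<open>c\<close>, with contribution \<open>(-1)^c x^(c i + t c (c - 1) / 2)\<close>. The generating
  function is therefore a product over \<open>0 < i < t'\<close> of theta series, each of which is an infinite
  product by the Jacobi triple product identity. The identity enters in its finite form, a
  consequence of the \<open>q\<close>-binomial theorem, modulo powers of \<open>x\<close>.\<close>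

section \<open>Congruence modulo powers of the indeterminate\<close>

definition fps_cong :: "nat \<Rightarrow> rat fps \<Rightarrow> rat fps \<Rightarrow> bool" where
  "fps_cong n f g \<longleftrightarrow> fps_X ^ n dvd f - g"

lemma fps_cong_refl [simp]: "fps_cong n f f"
  by (simp add: fps_cong_def)

lemma fps_cong_sym: "fps_cong n f g \<Longrightarrow> fps_cong n g f"
  unfolding fps_cong_def by (subst dvd_diff_commute)

lemma fps_cong_trans [trans]: "fps_cong n f g \<Longrightarrow> fps_cong n g h \<Longrightarrow> fps_cong n f h"
  unfolding fps_cong_def using dvd_add[of "fps_X ^ n" "f - g" "g - h"] by simp

lemma fps_cong_mono: "fps_cong n f g \<Longrightarrow> m \<le> n \<Longrightarrow> fps_cong m f g"
  unfolding fps_cong_def using le_imp_power_dvd dvd_trans by blast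

lemma fps_cong_mult: "fps_cong n f g \<Longrightarrow> fps_cong n f' g' \<Longrightarrow> fps_cong n (f * f') (g * g')"
proof -
  assume "fps_cong n f g" "fps_cong n f' g'"
  then have "fps_X ^ n dvd (f - g) * f' + g * (f' - g')"
    unfolding fps_cong_def by (intro dvd_add dvd_mult dvd_mult2)
  then show ?thesis by (simp add: fps_cong_def algebra_simps)
qed

lemma fps_cong_prod:
  "(\<And>i. i \<in> A \<Longrightarrow> fps_cong n (f i) (g i)) \<Longrightarrow> fps_cong n (prod f A) (prod g A)"
  by (induction A rule: infinite_finite_induct) (auto intro: fps_cong_mult)

lemma fps_cong_sum:
  "(\<And>i. i \<in> A \<Longrightarrow> fps_cong n (f i) (g i)) \<Longrightarrow> fps_cong n (sum f A) (sum g A)"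
  by (auto simp: fps_cong_def sum_subtractf[symmetric] intro: dvd_sum)

lemma fps_cong_power: "fps_cong n f g \<Longrightarrow> fps_cong n (f ^ k) (g ^ k)"
  by (induction k) (auto intro: fps_cong_mult)

text \<open>A series with nonzero constant term is a unit and does not affect divisibility by powers
  of \<open>fps_X\<close>. Denominators and \<open>qpoch\<close> factors are removed in this
  way.\<close>

lemma fps_cong_cancel:
  assumes "fps_cong n (h * f) (h * g)" "fps_nth h 0 \<noteq> 0"
  shows "fps_cong n f g"
proof -
  have "is_unit h" using assms(2) by simp
  then show ?thesis
    using assms(1) dvd_mult_unit_iff'[of h "fps_X ^ n" "f - g"]
    by (simp add: fps_cong_def right_diff_distrib)
qed

lemma fps_cong_nth:
  assumes "fps_cong n f g" "m < n"
  shows "fps_nth f m = fps_nth g m"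
proof -
  obtain h where "f - g = fps_X ^ n * h" using assms(1) by (auto simp: fps_cong_def)
  then have "fps_nth (f - g) m = 0" using assms(2) by (simp add: fps_X_power_mult_nth)
  then show ?thesis by simp
qed

lemma fps_congI_nth:
  assumes "\<And>m. m < n \<Longrightarrow> fps_nth f m = fps_nth g m"
  shows "fps_cong n f g"
proof (cases "f = g")
  case False
  have "n \<le> subdegree (f - g)"
    using False assms by (intro subdegree_geI) auto
  then show ?thesis using False by (auto simp: fps_cong_def fps_dvd_iff)
qed simp

lemma fps_cong_one_minus: "n \<le> k \<Longrightarrow> fps_cong n (1 - fps_X ^ k) 1"
  by (simp add: fps_cong_def le_imp_power_dvd)

section \<open>The Jacobi triple product\<close>

text \<open>The Gaussian binomial coefficient, encoded by its Pascal recurrence to avoid division in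
  the ring.\<close>

fun qbinom :: "'a::comm_ring_1 \<Rightarrow> nat \<Rightarrow> nat \<Rightarrow> 'a" where
  "qbinom q n 0 = 1"
| "qbinom q 0 (Suc k) = 0"
| "qbinom q (Suc n) (Suc k) = q ^ Suc k * qbinom q n (Suc k) + qbinom q n k"

definition qpoch :: "'a::comm_ring_1 \<Rightarrow> nat \<Rightarrow> 'a" where
  "qpoch q n = (\<Prod>j=1..n. 1 - q ^ j)"

lemma qpoch_0 [simp]: "qpoch q 0 = 1"
  by (simp add: qpoch_def)

lemma qpoch_Suc: "qpoch q (Suc n) = qpoch q n * (1 - q ^ Suc n)"
  by (simp add: qpoch_def)

lemma qbinom_eq_0: "n < k \<Longrightarrow> qbinom q n k = 0"
  by (induction q n k rule: qbinom.induct) auto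

lemma choose_two_Suc: "Suc k choose 2 = (k choose 2) + k"
  by (simp add: numeral_2_eq_2)

text \<open>The product formula for Gaussian binomials, cleared of denominators. The recurrence
  reduces it to \<open>q ^ k * (1 - q ^ m) + (1 - q ^ k) = 1 - q ^ (k + m)\<close>.\<close>

lemma qbinom_qpoch: "qpoch q k * qpoch q m * qbinom q (k + m) k = qpoch q (k + m)"
proof (induction "k + m" arbitrary: k m)
  case 0
  then show ?case by simp
next
  case (Suc n)
  show ?case
  proof (cases k)
    case (Suc k')
    have n: "n = k' + m" using Suc Suc.hyps(2) by simp
    have A: "qpoch q k' * qpoch q m * qbinom q n k' = qpoch q n"
      using Suc.hyps(1)[of k' m] n by simp
    have B: "qpoch q k * qpoch q m * qbinom q n k = (1 - q ^ m) * qpoch q n"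
    proof (cases m)
      case 0
      then show ?thesis using Suc n by (simp add: qbinom_eq_0)
    next
      case (Suc m')
      then have "qpoch q k * qpoch q m' * qbinom q n k = qpoch q n"
        using Suc.hyps(1)[of k m'] n \<open>k = Suc k'\<close> by simp
      then show ?thesis using Suc by (simp add: qpoch_Suc algebra_simps)
    qed
    have "qpoch q k * qpoch q m * qbinom q (k + m) k
        = q ^ k * (qpoch q k * qpoch q m * qbinom q n k) + (1 - q ^ k) * (qpoch q k' * qpoch q m * qbinom q n k')"
      using Suc n by (simp add: qpoch_Suc algebra_simps)
    also have "\<dots> = (1 - q ^ (k + m)) * qpoch q n"
      unfolding A B by (simp add: algebra_simps power_add)
    also have "\<dots> = qpoch q (k + m)"
      using Suc n by (simp add: qpoch_Suc)
    finally show ?thesis .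
  qed simp
qed

text \<open>Splitting off the factor \<open>u + v\<close> leaves the product for
  \<open>v * q\<close>, hence the induction over arbitrary \<open>v\<close>. Collecting powers of
  \<open>v\<close> reproduces the recurrence of \<open>qbinom\<close>.\<close>

lemma qbinomial_theorem:
  "(\<Prod>j<n. u + v * q ^ j) = (\<Sum>k\<le>n. q ^ (k choose 2) * qbinom q n k * u ^ (n - k) * v ^ k)"
proof (induction n arbitrary: v)
  case 0
  then show ?case by (simp add: numeral_2_eq_2)
next
  case (Suc n)
  define T where "T = (\<lambda>k. q ^ ((k choose 2) + k) * qbinom q n k * u ^ (n - k) * v ^ k)"
  have "(\<Prod>j<Suc n. u + v * q ^ j) = (u + v) * (\<Prod>j<n. u + (v * q) * q ^ j)"
    by (subst prod.lessThan_Suc_shift) (simp add: mult_ac)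
  also have "(\<Prod>j<n. u + (v * q) * q ^ j) = (\<Sum>k\<le>n. T k)"
    unfolding Suc.IH by (intro sum.cong) (auto simp: T_def power_mult_distrib power_add mult_ac)
  also have "(u + v) * (\<Sum>k\<le>n. T k) = (\<Sum>k\<le>n. u * T k) + (\<Sum>k\<le>n. v * T k)"
    unfolding distrib_right by (simp only: sum_distrib_left)
  also have "(\<Sum>k\<le>n. u * T k) = (\<Sum>k\<le>Suc n. q ^ ((k choose 2) + k) * qbinom q n k * u ^ (Suc n - k) * v ^ k)"
    by (auto simp: T_def qbinom_eq_0 Suc_diff_le mult_ac intro!: sum.cong)
  also have "\<dots> = u ^ Suc n + (\<Sum>k\<le>n. q ^ (Suc k choose 2) * q ^ Suc k * qbinom q n (Suc k) * u ^ (n - k) * v ^ Suc k)"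
    by (subst sum.atMost_Suc_shift) (simp add: power_add mult_ac numeral_2_eq_2 del: binomial_Suc_Suc)
  also have "(\<Sum>k\<le>n. v * T k) = (\<Sum>k\<le>n. q ^ (Suc k choose 2) * qbinom q n k * u ^ (n - k) * v ^ Suc k)"
    by (auto simp: T_def choose_two_Suc mult_ac intro!: sum.cong)
  also have "u ^ Suc n + (\<Sum>k\<le>n. q ^ (Suc k choose 2) * q ^ Suc k * qbinom q n (Suc k) * u ^ (n - k) * v ^ Suc k) + \<dots>
     = (\<Sum>k\<le>Suc n. q ^ (k choose 2) * qbinom q (Suc n) k * u ^ (Suc n - k) * v ^ k)"
    unfolding sum.atMost_Suc_shift[of _ n] by (simp add: sum.distrib[symmetric] algebra_simps numeral_2_eq_2 del: binomial_Suc_Suc)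
  finally show ?case .
qed

text \<open>A factor of index above \<open>m\<close> differs from \<open>1\<close> only in degrees
  above \<open>m\<close>.\<close>

lemma qpoch_cong:
  assumes "0 < t" "m \<le> n"
  shows "fps_cong (Suc m) (qpoch (fps_X ^ t) n) (qpoch (fps_X ^ t) m)"
  using assms(2)
proof (induction rule: dec_induct)
  case (step n)
  have "Suc m \<le> t * Suc n"
    using assms(1) step.hyps by (cases t) auto
  then have "fps_cong (Suc m) (1 - (fps_X ^ t) ^ Suc n) 1"
    unfolding power_mult[symmetric] by (rule fps_cong_one_minus)
  from fps_cong_mult[OF step.IH this] show ?case
    by (simp add: qpoch_Suc)
qed simp

lemma qpoch_fps_nth_0 [simp]:
  assumes "0 < t"
  shows "fps_nth (qpoch (fps_X ^ t :: rat fps) n) 0 = 1"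
  using assms by (induction n) (auto simp: qpoch_Suc fps_mult_nth_0 simp del: power_Suc)

text \<open>By \<open>qbinom_qpoch\<close> the left side is a quotient of two products of two
  \<open>qpoch\<close> factors. All four indices are at least \<open>m\<close>, so the factors agree
  modulo \<open>fps_X ^ Suc m\<close> and cancel.\<close>

lemma qbinom_cong:
  assumes "0 < t" "m \<le> n" "m \<le> k" "k + m \<le> 2 * n"
  shows "fps_cong (Suc m) (qpoch (fps_X ^ t) n * qbinom (fps_X ^ t) (2 * n) k) 1"
proof -
  define q :: "rat fps" where "q = fps_X ^ t"
  define h where "h = qpoch q m"
  have h: "fps_cong (Suc m) (qpoch q n') h" if "m \<le> n'" for n'
    using qpoch_cong[OF assms(1) that] by (simp add: h_def q_def)
  have "qpoch q k * qpoch q (2 * n - k) * qbinom q (2 * n) k = qpoch q (2 * n)"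
    using qbinom_qpoch[of q k "2 * n - k"] assms by simp
  then have "qpoch q k * qpoch q (2 * n - k) * (qpoch q n * qbinom q (2 * n) k) = qpoch q (2 * n) * qpoch q n"
    by (simp add: mult_ac)
  note eq = this
  have "fps_cong (Suc m) (h * h * (qpoch q n * qbinom q (2 * n) k))
      (qpoch q k * qpoch q (2 * n - k) * (qpoch q n * qbinom q (2 * n) k))"
    using assms by (intro fps_cong_mult fps_cong_refl fps_cong_sym[OF h]) auto
  also note eq
  also have "fps_cong (Suc m) (qpoch q (2 * n) * qpoch q n) (h * h * 1)"
    using fps_cong_mult[OF h[of "2 * n"] h[of n]] assms by simp
  finally have "fps_cong (Suc m) (h * h * (qpoch q n * qbinom q (2 * n) k)) (h * h * 1)" .
  moreover have "fps_nth (h * h) 0 \<noteq> 0"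
    using assms(1) by (simp add: h_def q_def fps_mult_nth_0)
  ultimately show ?thesis
    using fps_cong_cancel unfolding q_def by blast
qed

section \<open>Theta exponents and the finite triple product\<close>

text \<open>For \<open>0 < i < t\<close> this is the sum of the first \<open>c\<close> terms of
  \<open>i, i + t, ...\<close> if \<open>c\<close> is nonnegative, and of the first
  \<open>- c\<close> terms of \<open>t - i, 2 * t - i, ...\<close> otherwise.\<close>

definition theta_exp :: "nat \<Rightarrow> nat \<Rightarrow> int \<Rightarrow> nat" where
  "theta_exp t i c = nat (c * int i + int t * (c * (c - 1) div 2))"

text \<open>The bound makes the conversion by \<open>nat\<close> in \<open>theta_exp\<close>
  faithful and leaves only finitely many \<open>c\<close> below any given degree.\<close>

lemma abs_le_theta_exp:
  assumes "0 < i" "i < t"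
  shows "\<bar>c\<bar> \<le> c * int i + int t * (c * (c - 1) div 2)"
proof (cases "0 < c")
  case True
  then have "c * 1 \<le> c * int i" using assms by (intro mult_left_mono) auto
  moreover have "0 \<le> int t * (c * (c - 1) div 2)"
    using True by (intro mult_nonneg_nonneg) (auto simp: div_int_pos_iff)
  ultimately show ?thesis using True by linarith
next
  case False
  then have "0 \<le> c * (c + 1)"
    by (cases "c = 0") (auto intro: mult_nonpos_nonpos)
  \<comment> \<open>The quadratic term outweighs the negative linear one: together they are at least
    \<open>(- c) * (t - i)\<close>.\<close>
  then have "- c * 2 \<le> c * (c - 1)" by (simp add: algebra_simps)
  then have "- c \<le> c * (c - 1) div 2" by linarith
  then have "int t * (- c) \<le> int t * (c * (c - 1) div 2)" by (intro mult_left_mono) auto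
  moreover have "c * (int t - 1) \<le> c * int i"
    using False assms by (intro mult_left_mono_neg) auto
  ultimately show ?thesis using False by (simp add: algebra_simps)
qed

lemma int_theta_exp:
  assumes "0 < i" "i < t"
  shows "int (theta_exp t i c) = c * int i + int t * (c * (c - 1) div 2)"
  using abs_le_theta_exp[OF assms, of c] by (simp add: theta_exp_def)

lemma theta_exp_ge:
  assumes "0 < i" "i < t"
  shows "nat \<bar>c\<bar> \<le> theta_exp t i c"
  using abs_le_theta_exp[OF assms, of c] by (simp add: theta_exp_def)

lemma int_choose_two: "int (k choose 2) = int k * (int k - 1) div 2"
  by (cases k) (simp_all add: choose_two zdiv_int algebra_simps)

lemma choose_two_shift:
  fixes n k :: nat
  defines "c \<equiv> int k - int n"
  shows "int (k choose 2) = int (n choose 2) + int n * c + c * (c - 1) div 2"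
proof -
  have *: "2 * (x * (x - 1) div 2) = x * (x - 1)" for x :: int
    by (intro dvd_mult_div_cancel) auto
  have "2 * int (k choose 2) = 2 * (int (n choose 2) + int n * c + c * (c - 1) div 2)"
    unfolding int_choose_two distrib_left * by (simp add: c_def algebra_simps)
  then show ?thesis by simp
qed

text \<open>The exponent of the \<open>k\<close>-th term of the \<open>q\<close>-binomial expansion,
  recentred at \<open>c = k - n\<close>. The terms \<open>n * t * c\<close> cancel, which explains
  the choice \<open>u = x^(n * t)\<close>.\<close>

lemma jacobi_exponent:
  assumes "0 < i" "i < t" "k \<le> 2 * n"
  shows "t * (k choose 2) + n * t * (2 * n - k) + i * k
    = n * t * n + i * n + t * (n choose 2) + theta_exp t i (int k - int n)"
proof -
  have "int (t * (k choose 2) + n * t * (2 * n - k) + i * k)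
    = int (n * t * n + i * n + t * (n choose 2) + theta_exp t i (int k - int n))"
    using assms(3) unfolding of_nat_add of_nat_mult int_theta_exp[OF assms(1,2)] choose_two_shift[of k n]
    by (simp add: of_nat_diff algebra_simps)
  then show ?thesis by linarith
qed

lemma prod_minus_X_power:
  "(\<Prod>j<n. - (fps_X ^ (i + j * t))) = (-1) ^ n * (fps_X :: rat fps) ^ (i * n + t * (n choose 2))"
proof (induction n)
  case (Suc n)
  have "i * Suc n + t * (Suc n choose 2) = (i * n + t * (n choose 2)) + (i + n * t)"
    unfolding choose_two_Suc by (simp add: algebra_simps)
  then show ?case
    unfolding prod.lessThan_Suc Suc.IH by (simp add: power_add del: binomial_Suc_Suc)
qed (simp add: numeral_2_eq_2)

text \<open>The \<open>q\<close>-binomial theorem with \<open>2 * n\<close> factors, \<open>q = x^t\<close>, \<open>u = x^(n * t)\<close> and \<open>v = - x^i\<close>; the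
  power of \<open>x\<close> in \<open>u\<close> avoids negative exponents and is cancelled in the end.\<close>

lemma finite_jacobi:
  assumes "0 < i" "i < t"
  shows "(\<Prod>j<n. (1 - fps_X ^ (i + j * t)) * (1 - fps_X ^ (Suc j * t - i)))
    = (\<Sum>c\<in>{- int n..int n}. (-1) ^ nat \<bar>c\<bar> * (fps_X :: rat fps) ^ theta_exp t i c
        * qbinom (fps_X ^ t) (2 * n) (nat (c + int n)))" (is "?Q = ?S")
proof -
  let ?X = "fps_X :: rat fps"
  let ?B = "n * t * n + i * n + t * (n choose 2)"
  have "?X ^ ?B * ((-1) ^ n * ?Q) = (\<Prod>j<2 * n. ?X ^ (n * t) + (- (?X ^ i)) * (?X ^ t) ^ j)"
  proof -
    have *: "{..<2 * n} = {..<n} \<union> {n..<n + n}" "{..<n} \<inter> {n..<n + n} = {}" by auto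
    have "(\<Prod>j<2 * n. ?X ^ (n * t) + (- (?X ^ i)) * (?X ^ t) ^ j)
       = (\<Prod>j<n. ?X ^ (n * t) - ?X ^ (i + j * t)) * (\<Prod>j=n..<n + n. ?X ^ (n * t) - ?X ^ (i + j * t))"
      unfolding *(1) by (subst prod.union_disjoint) (auto simp: power_add power_mult[symmetric] mult.commute[of t])
    also have "(\<Prod>j=n..<n + n. ?X ^ (n * t) - ?X ^ (i + j * t)) = (\<Prod>j<n. ?X ^ (n * t) * (1 - ?X ^ (i + j * t)))"
      by (subst prod.shift_bounds_nat_ivl[of _ 0 n n, simplified])
        (simp add: lessThan_atLeast0 algebra_simps power_add)
    \<comment> \<open>Here \<open>i + j * t < n * t\<close>, so the smaller power
      \<open>x^(i + j * t)\<close> is extracted. The exponents left over are those of the second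
      family of factors, in reverse order.\<close>
    also have "(\<Prod>j<n. ?X ^ (n * t) - ?X ^ (i + j * t))
        = (\<Prod>j<n. - (?X ^ (i + j * t)) * (1 - ?X ^ (Suc (n - Suc j) * t - i)))"
    proof (intro prod.cong refl)
      fix j assume j: "j \<in> {..<n}"
      have "n * t = (i + j * t) + (Suc (n - Suc j) * t - i)"
      proof -
        have "i \<le> Suc (n - Suc j) * t" using assms by simp
        moreover have "j * t + Suc (n - Suc j) * t = n * t"
          using j unfolding add_mult_distrib[symmetric] by simp
        ultimately show ?thesis by linarith
      qed
      then show "?X ^ (n * t) - ?X ^ (i + j * t) = - (?X ^ (i + j * t)) * (1 - ?X ^ (Suc (n - Suc j) * t - i))"
        by (metis (no_types, lifting) minus_diff_eq minus_mult_left mult.right_neutral power_add right_diff_distrib')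
    qed
    also have "\<dots> = (-1) ^ n * ?X ^ (i * n + t * (n choose 2)) * (\<Prod>j<n. 1 - ?X ^ (Suc j * t - i))"
      unfolding prod.distrib prod_minus_X_power
      by (subst (2) prod.nat_diff_reindex[symmetric]) simp
    also have "(\<Prod>j<n. ?X ^ (n * t) * (1 - ?X ^ (i + j * t))) = ?X ^ (n * t * n) * (\<Prod>j<n. 1 - ?X ^ (i + j * t))"
      by (simp add: prod.distrib power_mult)
    finally show ?thesis
      unfolding prod.distrib power_add by (simp only: mult_ac)
  qed
  also have "\<dots> = (\<Sum>k\<le>2 * n. (?X ^ t) ^ (k choose 2) * qbinom (?X ^ t) (2 * n) k
      * (?X ^ (n * t)) ^ (2 * n - k) * (- (?X ^ i)) ^ k)"
    by (rule qbinomial_theorem)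
  also have "\<dots> = (\<Sum>k\<le>2 * n. ?X ^ ?B * ((-1) ^ k * ?X ^ theta_exp t i (int k - int n) * qbinom (?X ^ t) (2 * n) k))"
  proof (intro sum.cong refl)
    fix k assume "k \<in> {..2 * n}"
    then have e: "t * (k choose 2) + n * t * (2 * n - k) + i * k = ?B + theta_exp t i (int k - int n)"
      using jacobi_exponent[OF assms] by simp
    have "(?X ^ t) ^ (k choose 2) * qbinom (?X ^ t) (2 * n) k * (?X ^ (n * t)) ^ (2 * n - k) * (- (?X ^ i)) ^ k
      = (-1) ^ k * ?X ^ (t * (k choose 2) + n * t * (2 * n - k) + i * k) * qbinom (?X ^ t) (2 * n) k"
      unfolding power_minus[of "?X ^ i"] by (simp only: power_add power_mult mult_ac)
    then show "(?X ^ t) ^ (k choose 2) * qbinom (?X ^ t) (2 * n) k * (?X ^ (n * t)) ^ (2 * n - k) * (- (?X ^ i)) ^ k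
      = ?X ^ ?B * ((-1) ^ k * ?X ^ theta_exp t i (int k - int n) * qbinom (?X ^ t) (2 * n) k)"
      unfolding e by (simp only: power_add mult_ac)
  qed
  also have "\<dots> = ?X ^ ?B * (\<Sum>k\<le>2 * n. (-1) ^ k * ?X ^ theta_exp t i (int k - int n) * qbinom (?X ^ t) (2 * n) k)"
    by (simp only: sum_distrib_left)
  also have "(\<Sum>k\<le>2 * n. (-1) ^ k * ?X ^ theta_exp t i (int k - int n) * qbinom (?X ^ t) (2 * n) k)
      = (\<Sum>c\<in>{- int n..int n}. (-1) ^ n * ((-1) ^ nat \<bar>c\<bar> * ?X ^ theta_exp t i c
        * qbinom (?X ^ t) (2 * n) (nat (c + int n))))"
  proof (rule sum.reindex_bij_witness[of _ "\<lambda>c. nat (c + int n)" "\<lambda>k. int k - int n"])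
    fix k assume "k \<in> {..2 * n}"
    \<comment> \<open>For \<open>c = k - n\<close> the sign splits as \<open>(-1) ^ n\<close> times
      \<open>(-1) ^ nat \<bar>c\<bar>\<close>; the constant part matches the sign extracted from the
      product.\<close>
    have "even k \<longleftrightarrow> even (n + nat \<bar>int k - int n\<bar>)"
      by (cases "k \<le> n") (auto simp: nat_diff_distrib)
    then have "(-1 :: rat fps) ^ k = (-1) ^ n * (-1) ^ nat \<bar>int k - int n\<bar>"
      unfolding power_add[symmetric] minus_one_power_iff by simp
    then show "(-1) ^ n * ((-1) ^ nat \<bar>int k - int n\<bar> * ?X ^ theta_exp t i (int k - int n)
        * qbinom (?X ^ t) (2 * n) (nat (int k - int n + int n)))
      = (-1) ^ k * ?X ^ theta_exp t i (int k - int n) * qbinom (?X ^ t) (2 * n) k"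
      by simp
  qed auto
  also have "\<dots> = (-1) ^ n * ?S" by (simp only: sum_distrib_left)
  finally show ?thesis by simp
qed

text \<open>The term of index \<open>c\<close> has degree at least \<open>\<bar>c\<bar>\<close>, so
  its Gaussian factor matters only in degrees below \<open>n - \<bar>c\<bar>\<close>, where
  \<open>qbinom_cong\<close> replaces it by \<open>1\<close>.\<close>

lemma jacobi_cong:
  assumes "0 < i" "i < t"
  shows "fps_cong n (qpoch (fps_X ^ t) n * (\<Prod>j<n. (1 - fps_X ^ (i + j * t)) * (1 - fps_X ^ (Suc j * t - i))))
    (\<Sum>c\<in>{- int n..int n}. (-1) ^ nat \<bar>c\<bar> * fps_X ^ theta_exp t i c)"
  unfolding finite_jacobi[OF assms] sum_distrib_left
proof (intro fps_cong_sum)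
  fix c assume c: "c \<in> {- int n..int n}"
  let ?q = "fps_X ^ t :: rat fps"
  define m where "m = n - nat \<bar>c\<bar>"
  have "fps_cong (Suc m) (qpoch ?q n * qbinom ?q (2 * n) (nat (c + int n))) 1"
    using c assms by (intro qbinom_cong) (auto simp: m_def)
  then have "fps_X ^ Suc m dvd qpoch ?q n * qbinom ?q (2 * n) (nat (c + int n)) - 1"
    by (simp add: fps_cong_def)
  then have "fps_X ^ theta_exp t i c * fps_X ^ Suc m
      dvd fps_X ^ theta_exp t i c * (qpoch ?q n * qbinom ?q (2 * n) (nat (c + int n)) - 1)"
    by (rule mult_dvd_mono[OF dvd_refl])
  then have "fps_X ^ (theta_exp t i c + Suc m)
      dvd (-1) ^ nat \<bar>c\<bar> * (fps_X ^ theta_exp t i c * (qpoch ?q n * qbinom ?q (2 * n) (nat (c + int n)) - 1))"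
    unfolding power_add by (rule dvd_mult)
  moreover have "n \<le> theta_exp t i c + Suc m"
    using theta_exp_ge[OF assms, of c] by (simp add: m_def)
  ultimately have "fps_X ^ n
      dvd (-1) ^ nat \<bar>c\<bar> * (fps_X ^ theta_exp t i c * (qpoch ?q n * qbinom ?q (2 * n) (nat (c + int n)) - 1))"
    using power_le_dvd by blast
  then show "fps_cong n (qpoch ?q n * ((-1) ^ nat \<bar>c\<bar> * fps_X ^ theta_exp t i c * qbinom ?q (2 * n) (nat (c + int n))))
      ((-1) ^ nat \<bar>c\<bar> * fps_X ^ theta_exp t i c)"
    by (simp add: fps_cong_def algebra_simps)
qed

section \<open>Maya sets\<close>

text \<open>A hook length is the difference of an element of this set and a smaller element of its
  complement, so \<open>t\<close>-cores are recognised by the set being closed under subtraction of \<open>t\<close>.\<close>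

definition maya :: "partition \<Rightarrow> int set" where
  "maya la = {int (part la i) - int i | i. 1 \<le> i}"

section \<open>Recovering a partition from its Maya set\<close>

lemma part_antimono:
  assumes "is_partition la" "1 \<le> i" "i \<le> i'"
  shows "part la i' \<le> part la i"
proof (cases "i < i' \<and> i' \<le> length la")
  case True
  then have "la ! (i' - 1) \<le> la ! (i - 1)"
    using assms by (auto simp: is_partition_def sorted_wrt_iff_nth_less)
  then show ?thesis using True assms by (simp add: part_def)
next
  case False
  then show ?thesis using assms by (cases "i = i'") (auto simp: part_def)
qed

lemma part_pos_iff:
  assumes "is_partition la"
  shows "0 < part la i \<longleftrightarrow> 1 \<le> i \<and> i \<le> length la"
  using assms nth_mem[of "i - 1" la] by (auto simp: is_partition_def part_def)

lemma partition_eqI: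
  assumes "is_partition la" "is_partition mu" "\<And>i. 1 \<le> i \<Longrightarrow> part la i = part mu i"
  shows "la = mu"
proof (rule nth_equalityI)
  have "1 \<le> i \<and> i \<le> length la \<longleftrightarrow> 1 \<le> i \<and> i \<le> length mu" for i
    using assms(3)[of i] part_pos_iff[OF assms(1), of i] part_pos_iff[OF assms(2), of i] by auto
  from this[of "length la"] this[of "length mu"] show len: "length la = length mu"
    by linarith
  fix i assume "i < length la"
  then show "la ! i = mu ! i"
    using assms(3)[of "Suc i"] len by (simp add: part_def)
qed

text \<open>Once the earlier values agree, each of \<open>f i\<close> and \<open>g i\<close> is
  attained by the other function only at an index at least \<open>i\<close>, so each bounds the
  other from above.\<close>

lemma strict_antimono_range_eq:
  fixes f g :: "nat \<Rightarrow> int"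
  assumes "\<And>i j. i \<in> I \<Longrightarrow> j \<in> I \<Longrightarrow> i < j \<Longrightarrow> f j < f i"
    and "\<And>i j. i \<in> I \<Longrightarrow> j \<in> I \<Longrightarrow> i < j \<Longrightarrow> g j < g i"
    and "f ` I = g ` I" and "i \<in> I"
  shows "f i = g i"
  using assms(4)
proof (induction i rule: less_induct)
  case (less i)
  have "f i \<in> g ` I" "g i \<in> f ` I" using assms(3) less.prems by auto
  then obtain j k where jk: "j \<in> I" "f i = g j" "k \<in> I" "g i = f k" by auto
  have "\<not> j < i" using less.IH[of j] jk assms(1)[of j i] less.prems by fastforce
  moreover have "\<not> k < i" using less.IH[of k] jk assms(2)[of k i] less.prems by fastforce
  ultimately have "g j \<le> g i" "f k \<le> f i"
    using assms(1)[of i k] assms(2)[of i j] jk less.prems by (metis linorder_neqE_nat order.refl order_less_imp_le)+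
  then show ?case using jk by simp
qed

lemma maya_inj:
  assumes "is_partition la" "is_partition mu" "maya la = maya mu"
  shows "la = mu"
proof (rule partition_eqI[OF assms(1,2)])
  fix i :: nat assume "1 \<le> i"
  moreover have "int (part la j) - int j < int (part la i) - int i"
    if "1 \<le> i" "i < j" "is_partition la" for i j la
    using part_antimono[OF that(3,1), of j] that by simp
  moreover have "(\<lambda>i. int (part la i) - int i) ` {1..} = (\<lambda>i. int (part mu i) - int i) ` {1..}"
    using assms(3) by (auto simp: maya_def image_def)
  ultimately have "int (part la i) - int i = int (part mu i) - int i"
    using assms(1,2) by (intro strict_antimono_range_eq[of "{1..}"]) auto
  then show "part la i = part mu i" by simp
qed

lemma mem_ferrers_iff: "(i, j) \<in> ferrers la \<longleftrightarrow> 1 \<le> j \<and> j \<le> part la i"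
  by (simp add: ferrers_def)

lemma mem_ferrers_iff_conjugate:
  assumes "is_partition la"
  shows "(i, j) \<in> ferrers la \<longleftrightarrow> 1 \<le> i \<and> i \<le> part (conjugate la) j"
proof -
  have "(i, j) \<in> ferrers la \<longleftrightarrow> (j, i) \<in> ferrers (conjugate la)"
    unfolding ferrers_conjugate[OF assms] by force
  then show ?thesis by (simp add: ferrers_def)
qed

lemma ferrers_index_pos: "(i, j) \<in> ferrers la \<Longrightarrow> 1 \<le> i \<and> 1 \<le> j"
  by (auto simp: ferrers_def part_def split: if_splits)

section \<open>Hook lengths and cores\<close>

text \<open>Corner, arm and leg are counted and regrouped into a row term, which lies in
  \<open>maya la\<close>, and a column term, which lies in its complement by
  \<open>maya_complement\<close>.\<close>

lemma hook_length_eq: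
  assumes "is_partition la" "(i, j) \<in> ferrers la"
  shows "int (hook_length la (i, j)) = (int (part la i) - int i) - (int j - 1 - int (part (conjugate la) j))"
proof -
  let ?q = "part (conjugate la)"
  have ij: "1 \<le> i" "1 \<le> j" "j \<le> part la i" "i \<le> ?q j"
    using assms mem_ferrers_iff[of i j la] mem_ferrers_iff_conjugate[of la i j] by auto
  have "hook la (i, j) = (\<lambda>j. (i, j)) ` {j..part la i} \<union> (\<lambda>i. (i, j)) ` {Suc i..?q j}"
  proof (intro set_eqI)
    fix b :: "nat \<times> nat"
    obtain i' j' where b: "b = (i', j')" by force
    have "(i', j') \<in> hook la (i, j) \<longleftrightarrow> (i' = i \<and> j \<le> j' \<and> j' \<le> part la i) \<or> (j' = j \<and> i < i' \<and> i' \<le> ?q j)"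
      using ij mem_ferrers_iff[of i' j' la] mem_ferrers_iff_conjugate[OF assms(1), of i' j']
      by (auto simp: hook_def)
    then show "b \<in> hook la (i, j) \<longleftrightarrow> b \<in> (\<lambda>j. (i, j)) ` {j..part la i} \<union> (\<lambda>i. (i, j)) ` {Suc i..?q j}"
      unfolding b by auto
  qed
  moreover have "card ((\<lambda>j. (i, j)) ` {j..part la i} \<union> (\<lambda>i. (i, j)) ` {Suc i..?q j})
      = card ((\<lambda>j. (i, j)) ` {j..part la i}) + card ((\<lambda>i. (i, j)) ` {Suc i..?q j})"
    by (intro card_Un_disjoint) auto
  ultimately have "hook_length la (i, j) = (Suc (part la i) - j) + (?q j - i)"
    unfolding hook_length_def by (simp add: card_image inj_on_def)
  then show ?thesis using ij by simp
qed

text \<open>The integers label the steps of the boundary path of the diagram: vertical steps belong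
  to rows and form \<open>maya la\<close>, horizontal steps belong to columns.\<close>

lemma maya_complement:
  assumes "is_partition la"
  shows "- maya la = {int j - 1 - int (part (conjugate la) j) | j. 1 \<le> j}"
proof -
  let ?q = "part (conjugate la)"
  \<comment> \<open>Equality would mean \<open>part la i + ?q j = i + j - 1\<close>, but this sum is
    at least \<open>i + j\<close> if the box \<open>(i, j)\<close> is in the diagram and at most
    \<open>i + j - 2\<close> if not.\<close>
  have "int (part la i) - int i \<noteq> int j - 1 - int (?q j)" if "1 \<le> i" "1 \<le> j" for i j
    using that mem_ferrers_iff[of i j la] mem_ferrers_iff_conjugate[OF assms, of i j] by linarith
  moreover have "\<exists>j\<ge>1. y = int j - 1 - int (?q j)" if "y \<notin> maya la" for y
  proof -
    have "int (part la i) - int i \<le> y" if "i = length la + nat \<bar>y\<bar> + 1" for i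
      using that by (simp add: part_def)
    then have ex: "\<exists>i. 1 \<le> i \<and> int (part la i) - int i \<le> y" by (metis le_add2)
    \<comment> \<open>Row \<open>i\<close> is the first with value at most \<open>y\<close>, hence
      below \<open>y\<close>, while row \<open>i - 1\<close>, if there is one, has value above
      \<open>y\<close>. So column \<open>j = y + i\<close> has length exactly
      \<open>i - 1\<close>.\<close>
    define i where "i = (LEAST i. 1 \<le> i \<and> int (part la i) - int i \<le> y)"
    have i: "1 \<le> i" "int (part la i) - int i \<le> y"
      using LeastI_ex[OF ex] by (auto simp: i_def)
    then have lt: "int (part la i) - int i < y" using that by (force simp: maya_def)
    define j where "j = nat (y + int i)"
    have j: "int j = y + int i" "1 \<le> j" using lt by (auto simp: j_def)
    have "i - 1 \<le> ?q j"
    proof (cases "i = 1")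
      case False
      then have "\<not> int (part la (i - 1)) - int (i - 1) \<le> y"
        using not_less_Least[of "i - 1" "\<lambda>i. 1 \<le> i \<and> int (part la i) - int i \<le> y", folded i_def] i
        by auto
      then have "(i - 1, j) \<in> ferrers la" using j i by (auto simp: mem_ferrers_iff)
      then show ?thesis using mem_ferrers_iff_conjugate[OF assms] by blast
    qed simp
    moreover have "(i, j) \<notin> ferrers la" using lt j by (simp add: mem_ferrers_iff)
    then have "\<not> i \<le> ?q j" using mem_ferrers_iff_conjugate[OF assms] i by blast
    ultimately have "y = int j - 1 - int (?q j)" using j i by linarith
    then show ?thesis using j by blast
  qed
  ultimately show ?thesis by (fastforce simp: maya_def)
qed

text \<open>Hook lengths are the positive differences between elements of \<open>maya la\<close> and
  integers outside it. A difference \<open>t * k\<close> is bridged by \<open>k\<close> subtractions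
  of \<open>t\<close>, so closure under one subtraction suffices.\<close>

lemma t_core_iff_maya:
  assumes "is_partition la" "0 < t"
  shows "t_core t la \<longleftrightarrow> (\<forall>x\<in>maya la. x - int t \<in> maya la)"
proof -
  let ?q = "part (conjugate la)"
  have "t_core t la \<longleftrightarrow> (\<forall>x\<in>maya la. \<forall>y\<in>- maya la. y < x \<longrightarrow> \<not> int t dvd x - y)"
  proof
    assume L: "t_core t la"
    show "\<forall>x\<in>maya la. \<forall>y\<in>- maya la. y < x \<longrightarrow> \<not> int t dvd x - y"
    proof (intro ballI impI)
      fix x y assume "x \<in> maya la" "y \<in> - maya la" "y < x"
      then obtain i j where ij: "1 \<le> i" "1 \<le> j" "x = int (part la i) - int i" "y = int j - 1 - int (?q j)"
        unfolding maya_complement[OF assms(1)] by (auto simp: maya_def)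
      have "(i, j) \<in> ferrers la"
        using ij \<open>y < x\<close> mem_ferrers_iff[of i j la] mem_ferrers_iff_conjugate[OF assms(1), of i j] by linarith
      then have "x - y = int (hook_length la (i, j))" "\<not> t dvd hook_length la (i, j)"
        using hook_length_eq[OF assms(1)] ij L by (auto simp: t_core_def)
      then show "\<not> int t dvd x - y" by simp
    qed
  next
    assume R: "\<forall>x\<in>maya la. \<forall>y\<in>- maya la. y < x \<longrightarrow> \<not> int t dvd x - y"
    show "t_core t la"
      unfolding t_core_def
    proof
      fix b assume b: "b \<in> ferrers la"
      obtain i j where ij: "b = (i, j)" by force
      have "1 \<le> i" "1 \<le> j" using ferrers_index_pos b ij by auto
      then have "int (part la i) - int i \<in> maya la" "int j - 1 - int (?q j) \<in> - maya la"
        unfolding maya_complement[OF assms(1)] by (auto simp: maya_def)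
      moreover have "int j - 1 - int (?q j) < int (part la i) - int i"
        using b ij mem_ferrers_iff[of i j la] mem_ferrers_iff_conjugate[OF assms(1), of i j] by auto
      ultimately show "\<not> t dvd hook_length la b"
        using R hook_length_eq[OF assms(1), of i j] b ij by (metis int_dvd_int_iff)
    qed
  qed
  also have "\<dots> \<longleftrightarrow> (\<forall>x\<in>maya la. x - int t \<in> maya la)"
  proof
    assume L: "\<forall>x\<in>maya la. \<forall>y\<in>- maya la. y < x \<longrightarrow> \<not> int t dvd x - y"
    show "\<forall>x\<in>maya la. x - int t \<in> maya la"
    proof
      fix x assume "x \<in> maya la"
      then have "x - int t \<in> - maya la \<longrightarrow> \<not> int t dvd x - (x - int t)" using L assms(2) by force
      then show "x - int t \<in> maya la" by auto
    qed
  next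
    assume R: "\<forall>x\<in>maya la. x - int t \<in> maya la"
    show "\<forall>x\<in>maya la. \<forall>y\<in>- maya la. y < x \<longrightarrow> \<not> int t dvd x - y"
    proof (intro ballI impI notI)
      fix x y assume xy: "x \<in> maya la" "y \<in> - maya la" "y < x" "int t dvd x - y"
      have *: "x - int k * int t \<in> maya la" for k
      proof (induction k)
        case (Suc k)
        then have "x - int k * int t - int t \<in> maya la" using R by blast
        then show ?case by (simp add: algebra_simps)
      qed (use xy in simp)
      obtain k where k: "x - y = int t * k" using xy(4) by (auto elim: dvdE)
      then have "0 < k" using xy(3) by (metis assms(2) diff_gt_0_iff_gt of_nat_0_less_iff zero_less_mult_pos)
      then have "y = x - int (nat k) * int t" using k by (simp add: algebra_simps)
      then show False using *[of "nat k"] xy(2) by (metis ComplD)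
    qed
  qed
  finally show ?thesis .
qed

section \<open>The Durfee square and doubled distinct partitions\<close>

text \<open>As parts do not increase, a square fits as soon as its last row is long enough, and
  every smaller square fits too.\<close>

lemma le_durfee_iff:
  assumes "is_partition la" "1 \<le> i"
  shows "i \<le> durfee la \<longleftrightarrow> i \<le> part la i"
proof -
  have sq: "{1..d} \<times> {1..d} \<subseteq> ferrers la \<longleftrightarrow> d = 0 \<or> d \<le> part la d" for d
  proof
    assume L: "{1..d} \<times> {1..d} \<subseteq> ferrers la"
    show "d = 0 \<or> d \<le> part la d"
    proof (cases "d = 0")
      case False
      then have "(d, d) \<in> ferrers la" using L by auto
      then show ?thesis by (simp add: mem_ferrers_iff)
    qed simp
  next
    assume R: "d = 0 \<or> d \<le> part la d"
    have "j \<le> part la i" if "i \<in> {1..d}" "j \<in> {1..d}" for i j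
      using R that part_antimono[OF assms(1), of i d] by auto
    then show "{1..d} \<times> {1..d} \<subseteq> ferrers la" by (auto simp: mem_ferrers_iff)
  qed
  define S where "S = {d. d = 0 \<or> d \<le> part la d}"
  have D: "durfee la = Max S" unfolding durfee_def S_def sq ..
  have "S \<subseteq> {..length la}"
    by (auto simp: S_def part_def split: if_splits)
  then have fin: "finite S" by (rule finite_subset) simp
  have "Max S \<in> S" using fin by (intro Max_in) (auto simp: S_def)
  moreover have "i \<le> Max S" if "i \<le> part la i"
    using fin that by (intro Max_ge) (auto simp: S_def)
  ultimately show ?thesis
    unfolding D using assms(2) part_antimono[OF assms(1,2), of "Max S"] by (auto simp: S_def)
qed

text \<open>For a doubled distinct partition, \<open>A\<close> is the set of the \<open>a\<^sub>i = \<lambda>\<^sub>i - i\<close> with \<open>i \<le> D(\<lambda>)\<close>.\<close>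

definition symmetric_maya :: "nat set \<Rightarrow> int set" where
  "symmetric_maya A = int ` A \<union> {- int n | n. 0 < n \<and> n \<notin> A}"

lemma maya_nonneg:
  assumes "is_partition la"
  shows "{x\<in>maya la. 0 \<le> x} = (\<lambda>i. int (part la i) - int i) ` {1..durfee la}"
  using le_durfee_iff[OF assms] by (force simp: maya_def)

lemma durfee_conjugate:
  assumes "is_partition la" "1 \<le> i"
  shows "i \<le> durfee la \<longleftrightarrow> i \<le> part (conjugate la) i"
  using le_durfee_iff[OF assms] mem_ferrers_iff[of i i la] mem_ferrers_iff_conjugate[OF assms(1), of i i] assms(2) by auto

lemma maya_neg:
  assumes "is_partition la"
  shows "{x. x \<notin> maya la \<and> x < 0} = (\<lambda>i. int i - 1 - int (part (conjugate la) i)) ` {1..durfee la}"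
proof -
  have "{x. x \<notin> maya la \<and> x < 0} = {x \<in> - maya la. x < 0}" by auto
  then show ?thesis
    unfolding maya_complement[OF assms] using durfee_conjugate[OF assms] by force
qed

text \<open>Both \<open>a\<^sub>i\<close> and \<open>b\<^sub>i + 1\<close> strictly decrease, so
  entrywise equality amounts to equality of sets. These sets are the nonnegative elements and the
  negatives of the missing negative integers.\<close>

lemma doubled_distinct_iff:
  assumes "is_partition la"
  shows "doubled_distinct la \<longleftrightarrow> uminus ` {x\<in>maya la. 0 \<le> x} = {x. x \<notin> maya la \<and> x < 0}"
proof -
  let ?f = "\<lambda>i. int (part la i) - int i" and ?g = "\<lambda>i. 1 + (int (part (conjugate la) i) - int i)"
  have mono: "int (part la j) - int j < int (part la i) - int i"
    if "1 \<le> i" "i < j" "is_partition la" for i j la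
    using part_antimono[OF that(3,1), of j] that by simp
  have "doubled_distinct la \<longleftrightarrow> (\<forall>i\<in>{1..durfee la}. ?f i = ?g i)"
    by (simp add: doubled_distinct_def add.commute)
  also have "\<dots> \<longleftrightarrow> ?f ` {1..durfee la} = ?g ` {1..durfee la}"
  proof
    assume "?f ` {1..durfee la} = ?g ` {1..durfee la}"
    then show "\<forall>i\<in>{1..durfee la}. ?f i = ?g i"
      by (intro ballI strict_antimono_range_eq[of "{1..durfee la}"])
        (auto intro: mono[OF _ _ assms] mono[OF _ _ is_partition_conjugate[OF assms]])
  qed auto
  also have "\<dots> \<longleftrightarrow> uminus ` (?f ` {1..durfee la}) = uminus ` (?g ` {1..durfee la})"
    by (subst inj_image_eq_iff) auto
  also have "uminus ` (?g ` {1..durfee la}) = {x. x \<notin> maya la \<and> x < 0}"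
    unfolding maya_neg[OF assms] image_image by (auto simp: image_def)
  finally show ?thesis unfolding maya_nonneg[OF assms] .
qed

lemma doubled_distinct_iff_symmetric_maya:
  assumes "is_partition la"
  shows "doubled_distinct la \<longleftrightarrow> (\<exists>A. finite A \<and> 0 \<notin> A \<and> maya la = symmetric_maya A)"
proof
  assume "doubled_distinct la"
  then have sym: "uminus ` {x\<in>maya la. 0 \<le> x} = {x. x \<notin> maya la \<and> x < 0}"
    using doubled_distinct_iff[OF assms] by simp
  define A where "A = {n. int n \<in> maya la}"
  \<comment> \<open>Reflection would send an element \<open>0\<close> to itself, which is not
    negative.\<close>
  have "0 \<notin> maya la" using sym by force
  then have 0: "0 \<notin> A" by (simp add: A_def)
  have neg: "- int n \<in> maya la \<longleftrightarrow> n \<notin> A" if "0 < n" for n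
  proof -
    have "- int n \<notin> maya la \<longleftrightarrow> - int n \<in> {x. x \<notin> maya la \<and> x < 0}" using that by simp
    also have "\<dots> \<longleftrightarrow> n \<in> A" unfolding sym[symmetric] by (auto simp: A_def)
    finally show ?thesis by blast
  qed
  have "x \<in> maya la \<longleftrightarrow> x \<in> symmetric_maya A" for x
  proof (cases "x < 0")
    case True
    then obtain n where n: "x = - int n" "0 < n" using neg_int_cases by blast
    then show ?thesis using neg[of n] by (auto simp: symmetric_maya_def)
  next
    case False
    then obtain n where n: "x = int n" using nonneg_int_cases by (metis not_less)
    then show ?thesis using 0 by (auto simp: symmetric_maya_def A_def)
  qed
  moreover have "finite A"
  proof -
    have "int ` A \<subseteq> {x\<in>maya la. 0 \<le> x}" by (auto simp: A_def)
    then have "finite (int ` A)" unfolding maya_nonneg[OF assms] by (rule finite_subset) simp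
    then show ?thesis by (simp add: finite_image_iff)
  qed
  ultimately show "\<exists>A. finite A \<and> 0 \<notin> A \<and> maya la = symmetric_maya A" using 0 by blast
next
  assume "\<exists>A. finite A \<and> 0 \<notin> A \<and> maya la = symmetric_maya A"
  then obtain A where A: "0 \<notin> A" "maya la = symmetric_maya A" by blast
  have "{x\<in>maya la. 0 \<le> x} = int ` A" using A by (auto simp: symmetric_maya_def)
  moreover have "{x. x \<notin> maya la \<and> x < 0} = (\<lambda>n. - int n) ` A"
  proof (intro set_eqI)
    fix x :: int
    show "x \<in> {x. x \<notin> maya la \<and> x < 0} \<longleftrightarrow> x \<in> (\<lambda>n. - int n) ` A"
    proof (cases "x < 0")
      case True
      then obtain n where n: "x = - int n" "0 < n" using neg_int_cases by blast
      then show ?thesis unfolding A by (auto simp: symmetric_maya_def)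
    next
      case False
      then show ?thesis using A(1) by (auto simp: image_def)
    qed
  qed
  ultimately show "doubled_distinct la"
    using doubled_distinct_iff[OF assms] by (simp add: image_image)
qed

lemma durfee_symmetric_maya:
  assumes "is_partition la" "0 \<notin> A" "maya la = symmetric_maya A"
  shows "durfee la = card A"
proof -
  have "{x\<in>maya la. 0 \<le> x} = int ` A" using assms by (auto simp: symmetric_maya_def)
  then have "card A = card {x\<in>maya la. 0 \<le> x}" by (simp add: card_image)
  also have "\<dots> = card {1..durfee la}"
    unfolding maya_nonneg[OF assms(1)]
  proof (intro card_image linorder_inj_onI)
    fix i j assume "i < j" "i \<in> {1..durfee la}"
    then show "int (part la i) - int i \<noteq> int (part la j) - int j"
      using part_antimono[OF assms(1), of i j] by auto
  qed auto
  finally show ?thesis by simp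
qed

lemma symmetric_maya_inj:
  assumes "0 \<notin> A" "0 \<notin> B" "symmetric_maya A = symmetric_maya B"
  shows "A = B"
proof -
  have "C = {n. int n \<in> symmetric_maya C}" if "0 \<notin> C" for C
    using that by (auto simp: symmetric_maya_def)
  then show ?thesis using assms by metis
qed

text \<open>The Ferrers diagram of the strict partition \<open>as\<close>, shifted along the diagonal, together with
  its reflection: each step adds a principal hook with arm \<open>a\<close> and leg \<open>a - 1\<close>.\<close>

fun shifted_double :: "nat list \<Rightarrow> partition" where
  "shifted_double [] = []"
| "shifted_double (a # as) =
    Suc a # map Suc (shifted_double as) @ replicate (a - 1 - length (shifted_double as)) 1"

text \<open>The three claims are proved together: prepending \<open>a\<close> requires that the
  previous diagram have fewer than \<open>a\<close> rows and parts of size at most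
  \<open>a\<close>.\<close>

lemma shifted_double_partition:
  assumes "sorted_wrt (>) as" "0 \<notin> set as"
  shows "is_partition (shifted_double as)"
    and "length (shifted_double as) = (case as of [] \<Rightarrow> 0 | a # _ \<Rightarrow> a)"
    and "\<forall>p\<in>set (shifted_double as). p \<le> (case as of [] \<Rightarrow> 0 | a # _ \<Rightarrow> Suc a)"
  using assms
proof (induction as)
  case Nil
  {
    case 1
    show ?case by (simp add: is_partition_def)
  next
    case 2
    show ?case by simp
  next
    case 3
    show ?case by simp
  }
next
  case (Cons a as)
  have prems: "sorted_wrt (>) as" "0 \<notin> set as" if "sorted_wrt (>) (a # as)" "0 \<notin> set (a # as)"
    using that by auto
  have len: "length (shifted_double as) < a" if "sorted_wrt (>) (a # as)" "0 \<notin> set (a # as)"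
    using Cons.IH(2)[OF prems[OF that]] that by (cases as) auto
  have le: "p \<le> a" if "sorted_wrt (>) (a # as)" "0 \<notin> set (a # as)" "p \<in> set (shifted_double as)" for p
  proof -
    have "p \<le> (case as of [] \<Rightarrow> 0 | a # _ \<Rightarrow> Suc a)"
      using Cons.IH(3)[OF prems[OF that(1,2)]] that(3) by blast
    then show ?thesis using that(1) by (cases as) auto
  qed
  {
    case 1
    have "is_partition (shifted_double as)"
      using Cons.IH(1)[OF prems] 1 by blast
    then show ?case
      using le[OF 1] by (auto simp: is_partition_def sorted_wrt_append sorted_wrt_map sorted_wrt_iff_nth_less[of _ "replicate _ _"])
  next
    case 2
    then show ?case using len by simp
  next
    case 3
    then show ?case using le[OF 3] by auto
  }
qed

text \<open>The hook added for \<open>a\<close> has \<open>a + 1\<close> boxes in its row and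
  \<open>a - 1\<close> more in its column; the truncated subtraction is exact because the previous
  diagram has fewer than \<open>a\<close> rows.\<close>

lemma weight_shifted_double:
  assumes "sorted_wrt (>) as" "0 \<notin> set as"
  shows "weight (shifted_double as) = 2 * sum_list as"
  using assms
proof (induction as)
  case (Cons a as)
  have "length (shifted_double as) < a"
    using shifted_double_partition(2)[of as] Cons.prems by (cases as) auto
  moreover have "sum_list (map Suc xs) = sum_list xs + length xs" for xs
    by (induction xs) auto
  moreover have "sum_list (shifted_double as) = 2 * sum_list as"
    using Cons by (simp add: weight_def)
  ultimately show ?case
    by (simp add: weight_def sum_list_replicate)
qed (simp add: weight_def)

lemma symmetric_maya_insert:
  assumes "0 < a" "a \<notin> A"
  shows "symmetric_maya (insert a A) = {int a} \<union> (symmetric_maya A - {- int a})"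
proof (intro set_eqI)
  fix x :: int
  show "x \<in> symmetric_maya (insert a A) \<longleftrightarrow> x \<in> {int a} \<union> (symmetric_maya A - {- int a})"
  proof (cases "x < 0")
    case True
    then obtain n where "x = - int n" "0 < n" using neg_int_cases by blast
    then show ?thesis by (auto simp: symmetric_maya_def)
  next
    case False
    then obtain n where "x = int n" using nonneg_int_cases by (metis not_less)
    then show ?thesis using assms by (auto simp: symmetric_maya_def)
  qed
qed

text \<open>In one step each row of index below \<open>a\<close> moves down by one and grows by one,
  which keeps its value. Later rows are empty and stay so; thus \<open>- a\<close> is lost and the
  new first row supplies \<open>a\<close>.\<close>

lemma maya_shifted_double:
  assumes "sorted_wrt (>) as" "0 \<notin> set as"
  shows "maya (shifted_double as) = symmetric_maya (set as)"
  using assms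
proof (induction as)
  case Nil
  show ?case by (auto simp: maya_def symmetric_maya_def part_def)
next
  case (Cons a as)
  define la mu where la_def: "la = shifted_double as" and mu_def: "mu = shifted_double (a # as)"
  have len: "length la < a"
    using shifted_double_partition(2)[of as] Cons.prems by (cases as) (auto simp: la_def)
  have IH: "maya la = symmetric_maya (set as)" using Cons by (simp add: la_def)
  have a: "0 < a" "a \<notin> set as" using Cons.prems by auto
  have 1: "part mu 1 = Suc a" by (simp add: part_def mu_def)
  have 2: "part mu (Suc i) = (if i < a then Suc (part la i) else 0)" if "1 \<le> i" for i
    using that len by (auto simp: part_def nth_append nth_Cons' mu_def la_def)
  have 3: "part la i = 0" if "a \<le> i" for i using len that by (simp add: part_def)
  have "maya mu = {int a} \<union> {int (part mu (Suc i)) - int (Suc i) | i. 1 \<le> i}"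
  proof -
    have *: "{i::nat. 1 \<le> i} = insert 1 (Suc ` {i. 1 \<le> i})"
    proof (intro set_eqI)
      show "i \<in> {i. 1 \<le> i} \<longleftrightarrow> i \<in> insert 1 (Suc ` {i. 1 \<le> i})" for i
        by (cases i) auto
    qed
    have "(\<lambda>i. int (part mu i) - int i) ` {i. 1 \<le> i}
        = insert (int a) ((\<lambda>i. int (part mu (Suc i)) - int (Suc i)) ` {i. 1 \<le> i})"
      by (subst *, simp only: image_insert image_image 1) simp
    then show ?thesis unfolding maya_def setcompr_eq_image by simp
  qed
  also have "{int (part mu (Suc i)) - int (Suc i) | i. 1 \<le> i} = maya la - {- int a}"
  proof (intro set_eqI iffI)
    fix x assume "x \<in> {int (part mu (Suc i)) - int (Suc i) | i. 1 \<le> i}"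
    then obtain i where i: "1 \<le> i" "x = int (part mu (Suc i)) - int (Suc i)" by blast
    show "x \<in> maya la - {- int a}"
    proof (cases "i < a")
      case True
      then have "x = int (part la i) - int i" "x \<noteq> - int a" using i 2 by auto
      then show ?thesis using i unfolding maya_def by blast
    next
      case False
      then have "x = int (part la (Suc i)) - int (Suc i)" "x \<noteq> - int a" using i 2 3 by auto
      then show ?thesis unfolding maya_def by force
    qed
  next
    fix x assume "x \<in> maya la - {- int a}"
    then obtain i where i: "1 \<le> i" "x = int (part la i) - int i" "x \<noteq> - int a" by (auto simp: maya_def)
    show "x \<in> {int (part mu (Suc i)) - int (Suc i) | i. 1 \<le> i}"
    proof (cases "i < a")
      case True
      then have "x = int (part mu (Suc i)) - int (Suc i)" using i 2 by simp
      then show ?thesis using i by blast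
    next
      case False
      then have "a < i" "x = - int i" using i 3 by (auto simp: nat_less_le)
      then have "x = int (part mu (Suc (i - 1))) - int (Suc (i - 1))" "1 \<le> i - 1"
        using a 2[of "i - 1"] by auto
      then show ?thesis by blast
    qed
  qed
  finally show ?case
    unfolding IH mu_def[symmetric] using symmetric_maya_insert[OF a] by simp
qed

definition double_of_set :: "nat set \<Rightarrow> partition" where
  "double_of_set A = shifted_double (rev (sorted_list_of_set A))"

lemma double_of_set:
  assumes "finite A" "0 \<notin> A"
  shows "is_partition (double_of_set A)" "weight (double_of_set A) = 2 * \<Sum>A"
    "maya (double_of_set A) = symmetric_maya A"
proof -
  let ?as = "rev (sorted_list_of_set A)"
  have *: "sorted_wrt (>) ?as" "0 \<notin> set ?as"
    using assms by (auto simp: sorted_wrt_rev)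
  show "is_partition (double_of_set A)"
    unfolding double_of_set_def by (rule shifted_double_partition(1)[OF *])
  show "maya (double_of_set A) = symmetric_maya A"
    unfolding double_of_set_def maya_shifted_double[OF *] using assms by simp
  have "sum_list ?as = \<Sum>A"
    using sum_list_distinct_conv_sum_set[of ?as id] assms by (simp add: sum_list_rev)
  then show "weight (double_of_set A) = 2 * \<Sum>A"
    unfolding double_of_set_def weight_shifted_double[OF *] by simp
qed

lemma DD_term_double_of_set:
  assumes "finite A" "0 \<notin> A"
  shows "DD_term (double_of_set A) = (-1) ^ card A * fps_X ^ \<Sum>A"
proof -
  have "fps_const ((-1 :: rat) ^ n) = (-1) ^ n" for n
    by (cases "even n") (simp_all flip: fps_const_neg)
  then show ?thesis
    using double_of_set[OF assms] durfee_symmetric_maya[OF _ assms(2)]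
    by (simp add: DD_term_def delta_def)
qed

text \<open>The last condition says that \<open>symmetric_maya A\<close> is closed under subtraction of \<open>t\<close>.\<close>

definition core_sets :: "nat \<Rightarrow> nat set set" where
  "core_sets t = {A. finite A \<and> 0 \<notin> A \<and>
    (\<forall>n\<in>A. n \<noteq> t \<and> (t < n \<longrightarrow> n - t \<in> A) \<and> (n < t \<longrightarrow> t - n \<notin> A))}"

text \<open>Only elements of \<open>A\<close> impose conditions: for \<open>- n\<close> with
  \<open>n\<close> outside \<open>A\<close>, that \<open>n + t\<close> is also outside is the
  contrapositive of the clause for elements above \<open>t\<close>.\<close>

lemma symmetric_maya_closed_iff:
  assumes "0 \<notin> A" "0 < t"
  shows "(\<forall>x\<in>symmetric_maya A. x - int t \<in> symmetric_maya A) \<longleftrightarrow>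
    (\<forall>n\<in>A. n \<noteq> t \<and> (t < n \<longrightarrow> n - t \<in> A) \<and> (n < t \<longrightarrow> t - n \<notin> A))"
proof -
  have nonneg: "int n \<in> symmetric_maya A \<longleftrightarrow> n \<in> A" for n
    using assms by (auto simp: symmetric_maya_def)
  have neg: "- int n \<in> symmetric_maya A \<longleftrightarrow> n \<notin> A" if "0 < n" for n
    using that assms by (auto simp: symmetric_maya_def)
  have pos: "int n - int t \<in> symmetric_maya A \<longleftrightarrow> n \<noteq> t \<and> (t < n \<longrightarrow> n - t \<in> A) \<and> (n < t \<longrightarrow> t - n \<notin> A)" for n
  proof (cases n t rule: linorder_cases)
    case less
    then show ?thesis using neg[of "t - n"] by (simp add: of_nat_diff)
  next
    case equal
    then show ?thesis using nonneg[of 0] assms by simp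
  next
    case greater
    then show ?thesis using nonneg[of "n - t"] by (simp add: of_nat_diff)
  qed
  show ?thesis
  proof
    assume L: "\<forall>x\<in>symmetric_maya A. x - int t \<in> symmetric_maya A"
    show "\<forall>n\<in>A. n \<noteq> t \<and> (t < n \<longrightarrow> n - t \<in> A) \<and> (n < t \<longrightarrow> t - n \<notin> A)"
      using L nonneg pos by blast
  next
    assume R: "\<forall>n\<in>A. n \<noteq> t \<and> (t < n \<longrightarrow> n - t \<in> A) \<and> (n < t \<longrightarrow> t - n \<notin> A)"
    show "\<forall>x\<in>symmetric_maya A. x - int t \<in> symmetric_maya A"
    proof
      fix x assume x: "x \<in> symmetric_maya A"
      show "x - int t \<in> symmetric_maya A"
      proof (cases "x < 0")
        case True
        then obtain n where n: "x = - int n" "0 < n" using neg_int_cases by blast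
        then have "n \<notin> A" using x neg by simp
        then have "n + t \<notin> A" using R n by force
        then show ?thesis using neg[of "n + t"] n by (simp add: algebra_simps)
      next
        case False
        then obtain n where n: "x = int n" using nonneg_int_cases by (metis not_less)
        then show ?thesis using x R nonneg pos by blast
      qed
    qed
  qed
qed

lemma bij_betw_double_of_set:
  assumes "0 < t"
  shows "bij_betw double_of_set (core_sets t) (DD t)"
proof -
  have DD_iff: "la \<in> DD t \<longleftrightarrow> is_partition la \<and> (\<exists>A\<in>core_sets t. maya la = symmetric_maya A)" for la
  proof (cases "is_partition la")
    case True
    have "la \<in> DD t \<longleftrightarrow> (\<exists>A. finite A \<and> 0 \<notin> A \<and> maya la = symmetric_maya A) \<and>
        (\<forall>x\<in>maya la. x - int t \<in> maya la)"
      using True doubled_distinct_iff_symmetric_maya[of la] t_core_iff_maya[OF _ assms, of la]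
      by (simp add: DD_def)
    also have "\<dots> \<longleftrightarrow> (\<exists>A. finite A \<and> 0 \<notin> A \<and>
        (\<forall>x\<in>symmetric_maya A. x - int t \<in> symmetric_maya A) \<and> maya la = symmetric_maya A)"
      by metis
    also have "\<dots> \<longleftrightarrow> (\<exists>A\<in>core_sets t. maya la = symmetric_maya A)"
      using symmetric_maya_closed_iff[OF _ assms] unfolding core_sets_def by blast
    finally show ?thesis using True by simp
  qed (simp add: DD_def)
  have double: "is_partition (double_of_set A)" "maya (double_of_set A) = symmetric_maya A" "0 \<notin> A"
    if "A \<in> core_sets t" for A
    using that double_of_set[of A] by (auto simp: core_sets_def)
  show ?thesis
  proof (rule bij_betwI')
    fix A B assume "A \<in> core_sets t" "B \<in> core_sets t"
    then show "double_of_set A = double_of_set B \<longleftrightarrow> A = B"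
      using double(2,3) symmetric_maya_inj by metis
  next
    fix A assume "A \<in> core_sets t"
    then show "double_of_set A \<in> DD t"
      using double(1,2) unfolding DD_iff by blast
  next
    fix la assume "la \<in> DD t"
    then obtain A where "is_partition la" "A \<in> core_sets t" "maya la = symmetric_maya A"
      unfolding DD_iff by blast
    moreover from this have "la = double_of_set A"
      using double(1,2) by (intro maya_inj) simp_all
    ultimately show "\<exists>A\<in>core_sets t. la = double_of_set A" by blast
  qed
qed

section \<open>Core sets\<close>

text \<open>The elements congruent to \<open>i\<close> or \<open>- i\<close> modulo \<open>t\<close> of a core set: by symmetry of the Maya
  set, at most one of the two classes is inhabited, and the sign of \<open>c\<close> tells which.\<close>

definition runner :: "nat \<Rightarrow> nat \<Rightarrow> int \<Rightarrow> nat set" where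
  "runner t i c = (\<lambda>j. i + j * t) ` {..<nat c} \<union> (\<lambda>j. t - i + j * t) ` {..<nat (- c)}"

text \<open>The residues \<open>0\<close> and \<open>t'\<close> are their own negatives modulo
  \<open>2 * t'\<close>, so they are empty in a core set; each remaining pair of opposite residues
  is indexed by its smaller member.\<close>

definition core_set_of :: "nat \<Rightarrow> (nat \<Rightarrow> int) \<Rightarrow> nat set" where
  "core_set_of t' c = (\<Union>i\<in>{1..<t'}. runner (2 * t') i (c i))"

lemma residue_unique:
  fixes a b t :: nat
  assumes "a < t" "b < t"
  shows "a + j * t = b + k * t \<longleftrightarrow> a = b \<and> j = k"
proof
  assume eq: "a + j * t = b + k * t"
  from arg_cong[OF eq, of "\<lambda>n. n mod t"] arg_cong[OF eq, of "\<lambda>n. n div t"]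
  show "a = b \<and> j = k" using assms by simp
qed auto

lemma mem_runner_iff:
  assumes "0 < i" "i < t" "r < t"
  shows "r + j * t \<in> runner t i c \<longleftrightarrow> (r = i \<and> int j < c) \<or> (r = t - i \<and> int j < - c)"
proof -
  have "r + j * t \<in> runner t i c \<longleftrightarrow>
    (\<exists>k<nat c. r + j * t = i + k * t) \<or> (\<exists>k<nat (- c). r + j * t = (t - i) + k * t)"
    by (auto simp: runner_def)
  then show ?thesis
    using assms residue_unique[of r t i] residue_unique[of r t "t - i"] by (auto simp: zless_nat_eq_int_zless)
qed

lemma mem_core_set_of_iff:
  assumes "r < 2 * t'"
  shows "r + j * (2 * t') \<in> core_set_of t' c \<longleftrightarrow>
    (0 < r \<and> r < t' \<and> int j < c r) \<or> (t' < r \<and> int j < - c (2 * t' - r))"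
proof -
  have "r + j * (2 * t') \<in> runner (2 * t') i (c i) \<longleftrightarrow> (r = i \<and> int j < c i) \<or> (r = 2 * t' - i \<and> int j < - c i)"
    if "i \<in> {1..<t'}" for i
    using mem_runner_iff[of i "2 * t'" r j "c i"] assms that by simp
  then have "r + j * (2 * t') \<in> core_set_of t' c \<longleftrightarrow>
      (\<exists>i\<in>{1..<t'}. r = i \<and> int j < c i) \<or> (\<exists>i\<in>{1..<t'}. r = 2 * t' - i \<and> int j < - c i)"
    unfolding core_set_of_def UN_iff by blast
  also have "(\<exists>i\<in>{1..<t'}. r = i \<and> int j < c i) \<longleftrightarrow> 0 < r \<and> r < t' \<and> int j < c r"
    by auto
  also have "(\<exists>i\<in>{1..<t'}. r = 2 * t' - i \<and> int j < - c i) \<longleftrightarrow> t' < r \<and> int j < - c (2 * t' - r)"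
    using assms by (auto intro!: bexI[of _ "2 * t' - r"])
  finally show ?thesis .
qed

text \<open>Subtracting \<open>2 * t'\<close> lowers the position \<open>j\<close> by one. At
  \<open>j = 0\<close> the opposite residue is empty because \<open>c i\<close> and
  \<open>- c i\<close> are not both positive.\<close>

lemma core_set_of_mem:
  assumes "0 < t'"
  shows "core_set_of t' c \<in> core_sets (2 * t')"
proof -
  let ?t = "2 * t'" and ?A = "core_set_of t' c"
  have "finite ?A" by (simp add: core_set_of_def runner_def)
  moreover have "0 \<notin> ?A" using mem_core_set_of_iff[of 0 t' 0 c] assms by simp
  moreover have "n \<noteq> ?t \<and> (?t < n \<longrightarrow> n - ?t \<in> ?A) \<and> (n < ?t \<longrightarrow> ?t - n \<notin> ?A)" if "n \<in> ?A" for n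
  proof -
    define r j where "r = n mod ?t" and "j = n div ?t"
    have n: "n = r + j * ?t" "r < ?t"
      using assms mod_div_mult_eq[of n ?t, symmetric] unfolding r_def j_def by auto
    have mem: "(0 < r \<and> r < t' \<and> int j < c r) \<or> (t' < r \<and> int j < - c (?t - r))"
      using that mem_core_set_of_iff[OF n(2), of j c] n by simp
    show ?thesis
    proof (cases j)
      case 0
      then have "?t - r + 0 * ?t \<notin> ?A"
        using mem n(2) mem_core_set_of_iff[of "?t - r" t' 0 c] by auto
      then show ?thesis using n 0 by auto
    next
      case (Suc k)
      then have "r + k * ?t \<in> ?A" using mem mem_core_set_of_iff[OF n(2), of k c] by auto
      moreover have "r \<noteq> 0" using mem by auto
      ultimately show ?thesis using n Suc by auto
    qed
  qed
  ultimately show ?thesis by (simp add: core_sets_def)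
qed

lemma int_eqI_nat_less:
  assumes "\<And>j. int j < a \<longleftrightarrow> int j < b" "\<And>j. int j < - a \<longleftrightarrow> int j < - b"
  shows "a = b"
  using assms(1)[of "nat a"] assms(1)[of "nat b"] assms(2)[of "nat (- a)"] assms(2)[of "nat (- b)"]
  by linarith

lemma bij_betw_core_set_of:
  assumes "0 < t'"
  shows "bij_betw (core_set_of t') ({1..<t'} \<rightarrow>\<^sub>E UNIV) (core_sets (2 * t'))"
proof (rule bij_betwI')
  let ?t = "2 * t'"
  fix c d :: "nat \<Rightarrow> int"
  assume cd: "c \<in> {1..<t'} \<rightarrow>\<^sub>E UNIV" "d \<in> {1..<t'} \<rightarrow>\<^sub>E UNIV"
  show "core_set_of t' c = core_set_of t' d \<longleftrightarrow> c = d"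
  proof
    assume eq: "core_set_of t' c = core_set_of t' d"
    show "c = d"
    proof (rule PiE_ext[OF cd])
      fix i assume i: "i \<in> {1..<t'}"
      show "c i = d i"
      proof (rule int_eqI_nat_less)
        fix j :: nat
        show "int j < c i \<longleftrightarrow> int j < d i"
          using mem_core_set_of_iff[of i t' j c] mem_core_set_of_iff[of i t' j d] eq i by auto
        have "?t - i < ?t" "t' < ?t - i" "?t - (?t - i) = i" using i by auto
        then show "int j < - c i \<longleftrightarrow> int j < - d i"
          using mem_core_set_of_iff[of "?t - i" t' j c] mem_core_set_of_iff[of "?t - i" t' j d] eq by simp
      qed
    qed
  qed simp
next
  fix c :: "nat \<Rightarrow> int"
  show "core_set_of t' c \<in> core_sets (2 * t')" using core_set_of_mem[OF assms] .
next
  let ?t = "2 * t'"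
  fix A assume A: "A \<in> core_sets ?t"
  have A0: "finite A" "0 \<notin> A" using A by (auto simp: core_sets_def)
  have At: "n \<noteq> ?t" "?t < n \<Longrightarrow> n - ?t \<in> A" "n < ?t \<Longrightarrow> ?t - n \<notin> A" if "n \<in> A" for n
    using A that by (auto simp: core_sets_def)
  have "\<exists>m. \<forall>j. r + j * ?t \<in> A \<longleftrightarrow> j < m" for r
  proof -
    \<comment> \<open>By finiteness every residue class has a gap, and the core condition propagates
      it upwards, so the class is an initial segment of length \<open>m\<close>.\<close>
    define m where "m = (LEAST j. r + j * ?t \<notin> A)"
    have "inj (\<lambda>j. r + j * ?t)" using assms by (auto simp: inj_def)
    then have "\<not> range (\<lambda>j. r + j * ?t) \<subseteq> A"
      using A0(1) finite_subset finite_imageD[of "\<lambda>j. r + j * ?t" UNIV] by auto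
    then have "\<exists>j. r + j * ?t \<notin> A" by auto
    then have m: "r + m * ?t \<notin> A" unfolding m_def by (rule LeastI_ex)
    have "r + j * ?t \<notin> A" if "m \<le> j" for j
      using that
    proof (induction rule: dec_induct)
      case (step j)
      have "?t \<le> r + Suc j * ?t" "r + Suc j * ?t - ?t = r + j * ?t" by simp_all
      then show ?case using step.IH At(1,2)[of "r + Suc j * ?t"] by (metis le_neq_implies_less)
    qed (rule m)
    moreover have "r + j * ?t \<in> A" if "j < m" for j
      using not_less_Least[OF that[unfolded m_def]] by simp
    ultimately show ?thesis using not_less by blast
  qed
  then obtain m where m: "\<And>r j. r + j * ?t \<in> A \<longleftrightarrow> j < m r" by metis
  have m0: "m 0 = 0" using m[of 0 0] A0 by simp
  \<comment> \<open>An element \<open>t'\<close> would exclude \<open>?t - t'\<close>, which is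
    \<open>t'\<close> itself.\<close>
  have mt: "m t' = 0" using m[of t' 0] At(3)[of t'] assms by auto
  have opp: "m r = 0 \<or> m (?t - r) = 0" if "r < ?t" for r
    using m[of r 0] m[of "?t - r" 0] At(3)[of r] that by auto
  \<comment> \<open>By \<open>opp\<close> at most one of the two lengths is nonzero, so the
    difference determines both.\<close>
  define c where "c = restrict (\<lambda>i. int (m i) - int (m (?t - i))) {1..<t'}"
  have "n \<in> core_set_of t' c \<longleftrightarrow> n \<in> A" for n
  proof -
    define r j where "r = n mod ?t" and "j = n div ?t"
    have n: "n = r + j * ?t" "r < ?t"
      using assms mod_div_mult_eq[of n ?t, symmetric] unfolding r_def j_def by auto
    consider "r = 0" | "0 < r" "r < t'" | "r = t'" | "t' < r" by linarith
    then have "(0 < r \<and> r < t' \<and> int j < c r) \<or> (t' < r \<and> int j < - c (?t - r)) \<longleftrightarrow> j < m r"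
    proof cases
      case 2
      then show ?thesis using opp[OF n(2)] by (auto simp: c_def)
    next
      case 4
      then have "?t - r \<in> {1..<t'}" "?t - (?t - r) = r" using n(2) by auto
      then show ?thesis using opp[OF n(2)] 4 by (auto simp: c_def)
    qed (use m0 mt assms in auto)
    then show ?thesis using mem_core_set_of_iff[OF n(2), of j c] m n(1) by simp
  qed
  then have "A = core_set_of t' c" by blast
  moreover have "c \<in> {1..<t'} \<rightarrow>\<^sub>E UNIV" by (simp add: c_def)
  ultimately show "\<exists>c\<in>{1..<t'} \<rightarrow>\<^sub>E UNIV. A = core_set_of t' c" by blast
qed

section \<open>Sign and weight of a core set\<close>

lemma theta_exp_of_nat: "theta_exp t i (int n) = i * n + t * (n choose 2)"
proof -
  have "int n * int i + int t * (int n * (int n - 1) div 2) = int (i * n + t * (n choose 2))"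
    by (simp add: int_choose_two)
  then show ?thesis unfolding theta_exp_def by (simp only: nat_int)
qed

lemma theta_exp_uminus:
  assumes "i < t"
  shows "theta_exp t i (- c) = theta_exp t (t - i) c"
proof -
  have "- c * (- c - 1) = c * (c - 1) + c * 2" by (simp add: algebra_simps)
  then have "- c * (- c - 1) div 2 = c * (c - 1) div 2 + c" by simp
  then show ?thesis using assms by (simp add: theta_exp_def of_nat_diff algebra_simps)
qed

lemma prod_runner:
  assumes "0 < i" "i < t"
  shows "(\<Prod>n\<in>runner t i c. - (fps_X ^ n)) = (-1) ^ nat \<bar>c\<bar> * (fps_X :: rat fps) ^ theta_exp t i c"
proof -
  have *: "(\<Prod>m\<in>(\<lambda>j. r + j * t) ` {..<n}. - (fps_X ^ m)) = (-1) ^ n * (fps_X :: rat fps) ^ theta_exp t r (int n)"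
    for r n
    using assms by (subst prod.reindex) (auto simp: inj_on_def prod_minus_X_power theta_exp_of_nat)
  show ?thesis
  proof (cases "0 \<le> c")
    case True
    then obtain n where "c = int n" using nonneg_int_cases by blast
    then show ?thesis unfolding runner_def using *[of i n] by simp
  next
    case False
    then obtain n where "c = - int n" using neg_int_cases by (metis not_le)
    then show ?thesis
      unfolding runner_def using *[of "t - i" n] theta_exp_uminus[OF assms(2), of "int n"] by simp
  qed
qed

text \<open>The product of \<open>- (fps_X ^ n)\<close> over a set records its cardinality in the
  sign and its sum in the exponent, and it splits over the disjoint runners.\<close>

lemma DD_term_core_set_of:
  assumes "0 < t'"
  shows "DD_term (double_of_set (core_set_of t' c))
    = (\<Prod>i\<in>{1..<t'}. (-1) ^ nat \<bar>c i\<bar> * fps_X ^ theta_exp (2 * t') i (c i))"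
proof -
  let ?t = "2 * t'"
  have core: "finite (core_set_of t' c)" "0 \<notin> core_set_of t' c"
    using core_set_of_mem[OF assms, of c] by (auto simp: core_sets_def)
  have "runner ?t i (c i) \<inter> runner ?t k (c k) = {}" if "i \<in> {1..<t'}" "k \<in> {1..<t'}" "i \<noteq> k" for i k
  proof -
    have "n \<notin> runner ?t i (c i) \<or> n \<notin> runner ?t k (c k)" for n
    proof -
      have "n = n mod ?t + n div ?t * ?t" "n mod ?t < ?t"
        using assms mod_div_mult_eq[of n ?t, symmetric] by auto
      then show ?thesis
        using mem_runner_iff[of i ?t "n mod ?t" "n div ?t" "c i"]
          mem_runner_iff[of k ?t "n mod ?t" "n div ?t" "c k"] that by auto
    qed
    then show ?thesis by blast
  qed
  then have "(\<Prod>n\<in>core_set_of t' c. - (fps_X ^ n :: rat fps))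
      = (\<Prod>i\<in>{1..<t'}. \<Prod>n\<in>runner ?t i (c i). - (fps_X ^ n))"
    unfolding core_set_of_def by (intro prod.UNION_disjoint) (auto simp: runner_def)
  also have "\<dots> = (\<Prod>i\<in>{1..<t'}. (-1) ^ nat \<bar>c i\<bar> * fps_X ^ theta_exp ?t i (c i))"
    by (intro prod.cong prod_runner) auto
  finally show ?thesis
    unfolding DD_term_double_of_set[OF core] by (simp add: prod_uminus power_sum)
qed

section \<open>The generating function\<close>

text \<open>Terms outside \<open>B N\<close> vanish below degree \<open>N\<close>, so every finite
  set containing \<open>B (Suc n)\<close> already yields coefficient \<open>n\<close> of the
  sum.\<close>

lemma has_sum_fpsI:
  fixes f :: "'b \<Rightarrow> rat fps"
  assumes "\<And>N. finite (B N)" "\<And>N. B N \<subseteq> S"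
    and "\<And>N x. x \<in> S - B N \<Longrightarrow> fps_cong N (f x) 0"
    and "\<And>N. fps_cong N (\<Sum>x\<in>B N. f x) L"
  shows "(f has_sum L) S"
  unfolding has_sum_def
proof (rule tendsto_fpsI)
  fix n
  have "fps_nth (sum f Y) n = fps_nth L n" if Y: "finite Y" "B (Suc n) \<subseteq> Y" "Y \<subseteq> S" for Y
  proof -
    have "sum f Y = sum f (B (Suc n)) + sum f (Y - B (Suc n))"
      using Y by (simp add: sum.subset_diff)
    moreover have "fps_cong (Suc n) (sum f (Y - B (Suc n))) (\<Sum>x\<in>Y - B (Suc n). 0)"
      using Y assms(3) by (intro fps_cong_sum) auto
    ultimately show ?thesis
      using fps_cong_nth[OF assms(4), of n "Suc n"] fps_cong_nth[of "Suc n" _ _ n] by fastforce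
  qed
  then show "\<forall>\<^sub>F Y in finite_subsets_at_top S. fps_nth (sum f Y) n = fps_nth L n"
    unfolding eventually_finite_subsets_at_top using assms(1,2) by (intro exI[of _ "B (Suc n)"]) auto
qed

text \<open>Factor \<open>n\<close> changes no coefficient of degree at most \<open>n\<close>, so
  coefficient \<open>m\<close> is settled once the first \<open>Suc m\<close> factors are present;
  \<open>L\<close> collects these values.\<close>

lemma fps_prod_limit:
  fixes f :: "nat \<Rightarrow> rat fps"
  assumes "\<And>n. fps_cong (Suc n) (f n) 1"
  obtains L where "raw_has_prod f 0 L" "\<And>N M. N \<le> M \<Longrightarrow> fps_cong N (\<Prod>n<M. f n) L"
proof -
  define L where "L = Abs_fps (\<lambda>m. fps_nth (\<Prod>n<Suc m. f n) m)"
  have stable: "fps_cong N (\<Prod>n<M. f n) (\<Prod>n<N. f n)" if "N \<le> M" for N M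
    using that
  proof (induction rule: dec_induct)
    case (step M)
    then show ?case
      using fps_cong_mult[OF step.IH fps_cong_mono[OF assms[of M], of N]] by simp
  qed simp
  have L: "fps_cong N (\<Prod>n<M. f n) L" if "N \<le> M" for N M
  proof (rule fps_congI_nth)
    fix m assume "m < N"
    then show "fps_nth (\<Prod>n<M. f n) m = fps_nth L m"
      using fps_cong_nth[OF stable[of "Suc m" M], of m] that by (simp add: L_def)
  qed
  have "(\<lambda>n. \<Prod>i\<le>n. f i) \<longlonglongrightarrow> L"
  proof (rule tendsto_fpsI)
    fix m
    have "fps_nth (\<Prod>i\<le>n. f i) m = fps_nth L m" if "m \<le> n" for n
      using fps_cong_nth[OF L[of "Suc m" "Suc n"], of m] that by (simp add: lessThan_Suc_atMost)
    then show "\<forall>\<^sub>F n in sequentially. fps_nth (\<Prod>i\<le>n. f i) m = fps_nth L m"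
      by (auto simp: eventually_sequentially)
  qed
  \<comment> \<open>\<open>raw_has_prod\<close> demands a nonzero limit.\<close>
  moreover have "fps_nth L 0 = 1"
    using fps_cong_nth[OF L[of 1 1], of 0] fps_cong_nth[OF assms[of 0], of 0] by simp
  then have "L \<noteq> 0" by auto
  ultimately have "raw_has_prod f 0 L" by (simp add: raw_has_prod_def)
  then show ?thesis using L that by blast
qed

section \<open>Regrouping the product by residues\<close>

text \<open>Pairing \<open>i\<close> with \<open>2 * s - i\<close> prepares the two families of the
  triple product; \<open>s\<close> and \<open>2 * s\<close> are set apart as multiples of
  \<open>s\<close>.\<close>

lemma prod_symmetric_block:
  fixes h :: "nat \<Rightarrow> 'a::comm_monoid_mult"
  assumes "0 < s"
  shows "(\<Prod>m=1..2 * s. h m) = (\<Prod>i\<in>{1..<s}. h i * h (2 * s - i)) * (h s * h (2 * s))"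
proof -
  have "{1..2 * s} = {1..<s} \<union> ({Suc s..<2 * s} \<union> {s, 2 * s})"
    using assms by auto
  then have "(\<Prod>m=1..2 * s. h m) = prod h {1..<s} * (prod h {Suc s..<2 * s} * prod h {s, 2 * s})"
    using assms by (simp only:) (subst prod.union_disjoint; auto simp: mult_ac)+
  also have "prod h {Suc s..<2 * s} = (\<Prod>i\<in>{1..<s}. h (2 * s - i))"
    by (rule prod.reindex_bij_witness[of _ "\<lambda>i. 2 * s - i" "\<lambda>i. 2 * s - i"]) auto
  finally show ?thesis using assms by (simp add: prod.distrib mult_ac)
qed

lemma prod_split_multiples:
  fixes g :: "nat \<Rightarrow> 'a::comm_monoid_mult"
  assumes "0 < s"
  shows "(\<Prod>m=1..N * (2 * s). g m) =
    (\<Prod>i\<in>{1..<s}. \<Prod>j<N. g (i + j * (2 * s)) * g (Suc j * (2 * s) - i)) * (\<Prod>k=1..2 * N. g (s * k))"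
proof (induction N)
  case (Suc N)
  let ?t = "2 * s"
  have "(\<Prod>m=1..Suc N * ?t. g m) = (\<Prod>m=1..N * ?t. g m) * (\<Prod>m=N * ?t + 1..N * ?t + ?t. g m)"
    using prod.ub_add_nat[of 1 "N * ?t" g ?t] by (simp add: add.commute)
  also have "(\<Prod>m=N * ?t + 1..N * ?t + ?t. g m) = (\<Prod>m=1..?t. g (N * ?t + m))"
    using prod.shift_bounds_cl_nat_ivl[of g 1 "N * ?t" ?t] by (simp add: add.commute)
  also have "\<dots> = (\<Prod>i\<in>{1..<s}. g (N * ?t + i) * g (N * ?t + (?t - i))) * (g (N * ?t + s) * g (N * ?t + ?t))"
    by (rule prod_symmetric_block[OF assms])
  also have "(\<Prod>i\<in>{1..<s}. g (N * ?t + i) * g (N * ?t + (?t - i)))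
      = (\<Prod>i\<in>{1..<s}. g (i + N * ?t) * g (Suc N * ?t - i))"
    by (intro prod.cong refl) (auto simp: add.commute intro!: arg_cong2[of _ _ _ _ "(*)"] arg_cong[of _ _ g])
  also have "g (N * ?t + s) * g (N * ?t + ?t) = g (s * (2 * N + 1)) * g (s * (2 * N + 2))"
    by (simp add: algebra_simps)
  finally show ?case
    unfolding Suc.IH by (simp add: prod.distrib mult_ac)
qed simp

text \<open>Distributivity turns the sum over vectors \<open>c\<close> into a product of truncated
  theta series, one per residue, to which \<open>jacobi_cong\<close> applies.\<close>

lemma core_sum_cong:
  assumes "0 < t'"
  shows "fps_cong N
    (\<Sum>c\<in>{1..<t'} \<rightarrow>\<^sub>E {- int N..int N}. \<Prod>i\<in>{1..<t'}. (-1) ^ nat \<bar>c i\<bar> * fps_X ^ theta_exp (2 * t') i (c i))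
    (qpoch (fps_X ^ (2 * t')) N ^ (t' - 1) *
      (\<Prod>i\<in>{1..<t'}. \<Prod>j<N. (1 - fps_X ^ (i + j * (2 * t'))) * (1 - fps_X ^ (Suc j * (2 * t') - i))))"
proof -
  let ?t = "2 * t'"
  have "(\<Sum>c\<in>{1..<t'} \<rightarrow>\<^sub>E {- int N..int N}. \<Prod>i\<in>{1..<t'}. (-1) ^ nat \<bar>c i\<bar> * fps_X ^ theta_exp ?t i (c i))
      = (\<Prod>i\<in>{1..<t'}. \<Sum>k\<in>{- int N..int N}. (-1) ^ nat \<bar>k\<bar> * (fps_X :: rat fps) ^ theta_exp ?t i k)"
    by (subst prod_sum_PiE) auto
  moreover have "fps_cong N \<dots> (\<Prod>i\<in>{1..<t'}. qpoch (fps_X ^ ?t) N *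
      (\<Prod>j<N. (1 - fps_X ^ (i + j * ?t)) * (1 - fps_X ^ (Suc j * ?t - i))))"
    by (intro fps_cong_prod fps_cong_sym[OF jacobi_cong]) auto
  ultimately show ?thesis by (simp add: prod.distrib)
qed

lemma fps_divide_mult_unit:
  fixes f g :: "'a::field fps"
  assumes "fps_nth g 0 \<noteq> 0"
  shows "f / g * g = f"
  using assms by (simp add: fps_divide_unit mult.assoc inverse_mult_eq_1)

text \<open>Among the factors \<open>1 - fps_X ^ k\<close>, those with \<open>t'\<close> dividing
  \<open>k\<close> cancel against denominators and the others form the triple products. Taking
  \<open>N * (2 * t')\<close> factors keeps the residue blocks complete.\<close>

lemma prod_factor_cong:
  assumes "0 < t'"
  defines "f \<equiv> \<lambda>n. (1 - fps_X ^ Suc n) * (1 - fps_X ^ (Suc n * (2 * t'))) ^ (t' - 1) / (1 - fps_X ^ (Suc n * t')) :: rat fps"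
  shows "fps_cong N (\<Prod>n<N * (2 * t'). f n)
    (qpoch (fps_X ^ (2 * t')) N ^ (t' - 1) *
      (\<Prod>i\<in>{1..<t'}. \<Prod>j<N. (1 - fps_X ^ (i + j * (2 * t'))) * (1 - fps_X ^ (Suc j * (2 * t') - i))))"
    (is "fps_cong N ?P (_ * ?R)")
proof -
  let ?X = "fps_X :: rat fps" and ?t = "2 * t'"
  let ?M = "N * ?t"
  have shift: "(\<Prod>n<M. g (Suc n)) = (\<Prod>k=1..M. g k)" for M and g :: "nat \<Rightarrow> rat fps"
    by (simp add: prod.atLeast1_atMost_eq)
  have "f n * (1 - ?X ^ (Suc n * t')) = (1 - ?X ^ Suc n) * (1 - ?X ^ (Suc n * ?t)) ^ (t' - 1)" for n
    using assms(1) unfolding f_def by (intro fps_divide_mult_unit) simp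
  then have "?P * (\<Prod>n<?M. 1 - ?X ^ (Suc n * t')) = (\<Prod>n<?M. 1 - ?X ^ Suc n) * (\<Prod>n<?M. 1 - ?X ^ (Suc n * ?t)) ^ (t' - 1)"
    by (simp only: prod.distrib[symmetric] prod_power_distrib)
  then have eq: "?P * qpoch (?X ^ t') ?M = (\<Prod>k=1..?M. 1 - ?X ^ k) * qpoch (?X ^ ?t) ?M ^ (t' - 1)"
    unfolding shift[of "\<lambda>k. 1 - ?X ^ (k * t')"] shift[of "\<lambda>k. 1 - ?X ^ (k * ?t)"] shift[of "\<lambda>k. 1 - ?X ^ k"]
    by (simp only: qpoch_def power_mult[symmetric] mult.commute)
  have "(\<Prod>k=1..?M. 1 - ?X ^ k) = ?R * qpoch (?X ^ t') (2 * N)"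
    unfolding prod_split_multiples[OF assms(1), of _ N] qpoch_def by (simp only: power_mult[symmetric])
  with eq have eq: "qpoch (?X ^ t') ?M * ?P = qpoch (?X ^ t') (2 * N) * (qpoch (?X ^ ?t) ?M ^ (t' - 1) * ?R)"
    by (simp only: mult_ac)
  have "2 * N \<le> ?M" "N \<le> ?M" "0 < ?t" using assms(1) by simp_all
  \<comment> \<open>The numerator contains only \<open>2 * N\<close> multiples of \<open>t'\<close>;
    the surplus denominators are \<open>1\<close> modulo \<open>fps_X ^ N\<close>.\<close>
  have "fps_cong N (qpoch (?X ^ t') ?M) (qpoch (?X ^ t') (2 * N))"
    using qpoch_cong[OF assms(1) \<open>2 * N \<le> ?M\<close>] by (rule fps_cong_mono) simp
  then have "fps_cong N (qpoch (?X ^ t') ?M * ?P) (qpoch (?X ^ t') (2 * N) * ?P)"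
    by (intro fps_cong_mult) simp_all
  then have "fps_cong N (qpoch (?X ^ t') (2 * N) * ?P) (qpoch (?X ^ t') (2 * N) * (qpoch (?X ^ ?t) ?M ^ (t' - 1) * ?R))"
    unfolding eq by (rule fps_cong_sym)
  then have "fps_cong N ?P (qpoch (?X ^ ?t) ?M ^ (t' - 1) * ?R)"
    by (rule fps_cong_cancel) (use assms(1) in simp)
  moreover have "fps_cong N (qpoch (?X ^ ?t) ?M) (qpoch (?X ^ ?t) N)"
    using qpoch_cong[OF \<open>0 < ?t\<close> \<open>N \<le> ?M\<close>] by (rule fps_cong_mono) simp
  then have "fps_cong N (qpoch (?X ^ ?t) ?M ^ (t' - 1) * ?R) (qpoch (?X ^ ?t) N ^ (t' - 1) * ?R)"
    by (intro fps_cong_mult fps_cong_power fps_cong_refl)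
  ultimately show ?thesis by (rule fps_cong_trans)
qed

theorem lemma2p7:
  fixes t t' :: nat
  assumes "t = 2 * t'" and "0 < t"
  shows "DD_term summable_on DD t \<and>
    convergent_prod (\<lambda>n. let k = Suc n in
      (1 - fps_X ^ k) * (1 - fps_X ^ (k * t)) ^ (t' - 1) / (1 - fps_X ^ (k * t')) :: rat fps) \<and>
    (\<Sum>\<^sub>\<infinity>la\<in>DD t. DD_term la) =
    (\<Prod>n. let k = Suc n in
      (1 - fps_X ^ k) * (1 - fps_X ^ (k * t)) ^ (t' - 1) / (1 - fps_X ^ (k * t')))"
proof -
  have t': "0 < t'" using assms by simp
  define f :: "nat \<Rightarrow> rat fps" where
    "f = (\<lambda>n. (1 - fps_X ^ Suc n) * (1 - fps_X ^ (Suc n * t)) ^ (t' - 1) / (1 - fps_X ^ (Suc n * t')))"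
  \<comment> \<open>Multiplying by the denominator, a unit, leaves only factors
    \<open>1 - fps_X ^ d\<close> with \<open>d > n\<close>.\<close>
  have "fps_cong (Suc n) (f n) 1" for n
  proof (rule fps_cong_cancel)
    let ?d = "1 - fps_X ^ (Suc n * t') :: rat fps"
    have le: "Suc n \<le> Suc n * t'" "Suc n \<le> Suc n * t" using t' assms by (simp_all del: mult_Suc)
    show "fps_nth ?d 0 \<noteq> 0" using t' by simp
    then have "?d * f n = (1 - fps_X ^ Suc n) * (1 - fps_X ^ (Suc n * t)) ^ (t' - 1)"
      unfolding f_def by (subst mult.commute) (rule fps_divide_mult_unit)
    moreover have "fps_cong (Suc n) \<dots> (1 * 1 ^ (t' - 1))"
      using le by (intro fps_cong_mult fps_cong_power fps_cong_one_minus) simp_all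
    moreover have "fps_cong (Suc n) 1 ?d"
      using le by (intro fps_cong_sym[OF fps_cong_one_minus])
    ultimately show "fps_cong (Suc n) (?d * f n) (?d * 1)"
      using fps_cong_trans by simp
  qed
  then obtain L where L: "raw_has_prod f 0 L" "\<And>N M. N \<le> M \<Longrightarrow> fps_cong N (\<Prod>n<M. f n) L"
    using fps_prod_limit by blast
  let ?F = "\<lambda>c. \<Prod>i\<in>{1..<t'}. (-1) ^ nat \<bar>c i\<bar> * (fps_X :: rat fps) ^ theta_exp t i (c i)"
  have "(?F has_sum L) ({1..<t'} \<rightarrow>\<^sub>E UNIV)"
  proof (rule has_sum_fpsI[of "\<lambda>N. {1..<t'} \<rightarrow>\<^sub>E {- int N..int N}"])
    show "finite ({1..<t'} \<rightarrow>\<^sub>E {- int N..int N})" for N by (intro finite_PiE) auto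
    show "({1..<t'} \<rightarrow>\<^sub>E {- int N..int N}) \<subseteq> ({1..<t'} \<rightarrow>\<^sub>E UNIV)" for N by (rule PiE_mono) simp
  next
    fix N c assume c: "c \<in> ({1..<t'} \<rightarrow>\<^sub>E UNIV) - ({1..<t'} \<rightarrow>\<^sub>E {- int N..int N})"
    then obtain i where i: "i \<in> {1..<t'}" "c i \<notin> {- int N..int N}"
      by (auto simp: PiE_iff)
    have "N \<le> nat \<bar>c i\<bar>" using i(2) by auto
    also have "\<dots> \<le> theta_exp t i (c i)" using i(1) assms by (intro theta_exp_ge) auto
    finally have "fps_X ^ N dvd (-1) ^ nat \<bar>c i\<bar> * (fps_X :: rat fps) ^ theta_exp t i (c i)"
      by (intro dvd_mult le_imp_power_dvd)
    also have "\<dots> dvd ?F c" using i(1) by (intro dvd_prodI) auto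
    finally show "fps_cong N (?F c) 0" by (simp add: fps_cong_def)
  next
    fix N
    \<comment> \<open>\<open>N * t\<close> factors form the \<open>N\<close> full blocks of
      \<open>prod_factor_cong\<close> and suffice to fix the product modulo
      \<open>fps_X ^ N\<close>.\<close>
    have "N \<le> N * t" using assms by simp
    then show "fps_cong N (\<Sum>c\<in>{1..<t'} \<rightarrow>\<^sub>E {- int N..int N}. ?F c) L"
      using core_sum_cong[OF t', of N] prod_factor_cong[OF t', of N] L(2)[of N "N * t"]
      unfolding assms(1) f_def by (meson fps_cong_sym fps_cong_trans)
  qed
  also have "?F = (\<lambda>c. DD_term (double_of_set (core_set_of t' c)))"
    using DD_term_core_set_of[OF t'] assms(1) by simp
  finally have "(DD_term has_sum L) (DD t)"
    using has_sum_reindex_bij_betw[OF bij_betw_trans[OF bij_betw_core_set_of[OF t'] bij_betw_double_of_set], of DD_term L] assms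
    by (simp add: o_def)
  then have "DD_term summable_on DD t" "(\<Sum>\<^sub>\<infinity>la\<in>DD t. DD_term la) = L"
    by (auto simp: summable_on_def infsumI)
  moreover have "convergent_prod f" "prodinf f = L"
    using L(1) has_prod_unique[of f L] by (auto simp: convergent_prod_def has_prod_def)
  ultimately show ?thesis by (simp add: f_def Let_def)
qed

end
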